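(* Let $\mathcal{M}$ be a natural exponential family of order $d$ on $\mathbb{R}^d$ and let $\Theta\subseteq\mathbb{R}^d$ be any parameter space for $\mathcal{M}$ (not necessarily the natural one). Then the function $F_1:\Theta\to\mathbb{R}$ is given, for all $\theta\in\Theta$, by $$\begin{aligned}F_1(\theta)=&\ \frac18\sum_{i_1,\dots,i_4}\mathrm{AC}^{(4)}_{i_1\dots i_4}g^{i_1i_2}g^{i_3i_4}-\frac18\sum_{i_1,\dots,i_6}\mathrm{AC}^{(3)}_{i_1i_2i_3}\mathrm{AC}^{(3)}_{i_4i_5i_6}g^{i_1i_2}g^{i_3i_4}g^{i_5i_6}\\&-\frac1{12}\sum_{i_1,\dots,i_6}\mathrm{AC}^{(3)}_{i_1i_2i_3}\mathrm{AC}^{(3)}_{i_4i_5i_6}g^{i_1i_4}g^{i_2i_5}g^{i_3i_6}-\frac{d^2+2d}8,\end{aligned}$$ where all indices range from $1$ to $d$, $\mathrm{AC}^{(r)}$ are the Amari-Chentsov tensors on $\Theta$, and $g^{ij}$ are the entries of the inverse of the Fisher information metric on $\Theta$, all computed in the parameterisation $\Theta$ at $\theta$.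
   Context: Natural exponential family: $\Theta\subseteq\mathbb{R}^d$ is open, and $\mathcal{M}=\{p_1(\cdot,\theta)\mu_1:\theta\in\Theta\}$ is a set of probability measures on $\mathbb{R}^d$, where $\mu_1$ is a fixed measure on $\mathbb{R}^d$, $p_1(x,\theta)=\exp(x\cdot\eta(\theta)-\psi(\eta(\theta)))$, $\eta:\Theta\to\mathbb{R}^d$ is the reparameterisation map to the natural parameter space (a diffeomorphism onto its image, which is the open natural parameter space), and $\psi$ is the log-partition function, determined by normalisation. "Order $d$" means the family is minimal: $\mu_1$ is not supported on a proper affine subspace of $\mathbb{R}^d$. Amari-Chentsov tensors: for $r=1,2,3,\dots$, $$\mathrm{AC}^{(r)}_{i_1,\dots,i_r}=\int\Big(\prod_{j=1}^r\frac{\partial\log p_1(x,\theta)}{\partial\theta_{i_j}}\Big)p_1(x,\theta)\,d\mu_1(x).$$ The Fisher information metric on $\Theta$ has entries $g_{ij}(\theta)=-\int\frac{\partial^2\log p_1(x,\theta)}{\partial\theta_i\partial\theta_j}p_1(x,\theta)\,d\mu_1(x)$, and $g^{ij}=(g_\Theta(\theta)^{-1})_{ij}$. Definition of $F_1$: on the natural parameter space, with natural parameter $\eta$, cumulants $\kappa_{i_1\dots i_r}=\partial^r\psi/\partial\eta_{i_1}\cdots\partial\eta_{i_r}$ and $\gamma^{ij}$ the entries of the inverse of the Hessian matrix $(\partial^2\psi/\partial\eta_i\partial\eta_j)$, $$F_1^{\mathrm{nat}}(\eta)=\frac18\sum\kappa_{i_1\dots i_4}\gamma^{i_1i_2}\gamma^{i_3i_4}-\frac18\sum\kappa_{i_1i_2i_3}\kappa_{i_4i_5i_6}\gamma^{i_1i_2}\gamma^{i_3i_4}\gamma^{i_5i_6}-\frac1{12}\sum\kappa_{i_1i_2i_3}\kappa_{i_4i_5i_6}\gamma^{i_1i_4}\gamma^{i_2i_5}\gamma^{i_3i_6},$$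 with all indices summed from $1$ to $d$. On a general parameter space $\Theta$, $F_1(\theta)=F_1^{\mathrm{nat}}(\eta(\theta))$. (This is the coefficient of $n^{-1}$ in the integrand of the asymptotic expansion of the parametric complexity of $\mathcal{M}$.) *)

theory Defs
  imports "HOL-Probability.Probability"
begin

definition partial_deriv ::
    "'n::finite \<Rightarrow> (real ^ 'n \<Rightarrow> 'b::real_normed_vector) \<Rightarrow> real ^ 'n \<Rightarrow> 'b" where
  "partial_deriv i f x = vector_derivative (\<lambda>t::real. f (x + t *\<^sub>R axis i 1)) (at 0)"

fun partial_derivs ::
    "'n::finite list \<Rightarrow> (real ^ 'n \<Rightarrow> 'b::real_normed_vector) \<Rightarrow> real ^ 'n \<Rightarrow> 'b" where
  "partial_derivs [] f = f"
| "partial_derivs (i # is) f = partial_deriv i (partial_derivs is f)"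

text \<open>Smoothness of class \<open>C\<^sup>\<infinity>\<close> on an open set \<open>S\<close>.  Requiring Frechet differentiability
  of every iterated partial derivative also makes all of them continuous on \<open>S\<close>.\<close>

definition smooth_on :: "(real ^ 'n::finite) set \<Rightarrow> (real ^ 'n \<Rightarrow> 'b::real_normed_vector) \<Rightarrow> bool" where
  "smooth_on S f \<longleftrightarrow> (\<forall>is. \<forall>x\<in>S. partial_derivs is f differentiable (at x))"

definition diffeomorphism_between ::
    "(real ^ 'n::finite) set \<Rightarrow> (real ^ 'n) set \<Rightarrow> (real ^ 'n \<Rightarrow> real ^ 'n) \<Rightarrow> bool" where
  "diffeomorphism_between S T f \<longleftrightarrow>
     open S \<and> open T \<and> bij_betw f S T \<and> smooth_on S f \<and> smooth_on T (inv_into S f)"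

definition natural_parameter_space :: "(real ^ 'd::finite) measure \<Rightarrow> (real ^ 'd) set" where
  "natural_parameter_space \<mu> = {\<eta>. integrable \<mu> (\<lambda>x. exp (x \<bullet> \<eta>))}"

definition log_partition :: "(real ^ 'd::finite) measure \<Rightarrow> real ^ 'd \<Rightarrow> real" where
  "log_partition \<mu> \<eta> = ln (LINT x|\<mu>. exp (x \<bullet> \<eta>))"

definition nef_density ::
    "(real ^ 'd::finite) measure \<Rightarrow> (real ^ 'd \<Rightarrow> real ^ 'd) \<Rightarrow> real ^ 'd \<Rightarrow> real ^ 'd \<Rightarrow> real" where
  "nef_density \<mu> \<eta> x \<theta> = exp (x \<bullet> \<eta> \<theta> - log_partition \<mu> (\<eta> \<theta>))"

text \<open>\<open>M\<close> is a natural exponential family with carrier measure \<open>\<mu>\<close>, parameterised by \<open>\<Theta>\<close>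
  through the reparameterisation map \<open>\<eta>\<close> to the natural parameter.\<close>

definition natural_exponential_family ::
    "(real ^ 'd::finite) measure set \<Rightarrow> (real ^ 'd) measure \<Rightarrow>
     (real ^ 'd) set \<Rightarrow> (real ^ 'd \<Rightarrow> real ^ 'd) \<Rightarrow> bool" where
  "natural_exponential_family M \<mu> \<Theta> \<eta> \<longleftrightarrow>
     sets \<mu> = sets borel \<and>
     diffeomorphism_between \<Theta> (natural_parameter_space \<mu>) \<eta> \<and>
     M = (\<lambda>\<theta>. density \<mu> (\<lambda>x. ennreal (nef_density \<mu> \<eta> x \<theta>))) ` \<Theta> \<and>
     (\<forall>P\<in>M. prob_space P)"

text \<open>Order \<open>d\<close>: the carrier measure is not supported on a proper affine subspace.\<close>

definition minimal_carrier :: "(real ^ 'd::finite) measure \<Rightarrow> bool" where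
  "minimal_carrier \<mu> \<longleftrightarrow> (\<forall>A. affine A \<and> A \<noteq> UNIV \<longrightarrow> \<not> (AE x in \<mu>. x \<in> A))"

text \<open>The index list \<open>is = [i\<^sub>1, \<dots>, i\<^sub>r]\<close> determines the rank \<open>r\<close> of the tensor.\<close>

definition amari_chentsov ::
    "(real ^ 'd::finite) measure \<Rightarrow> (real ^ 'd \<Rightarrow> real ^ 'd \<Rightarrow> real) \<Rightarrow>
     'd list \<Rightarrow> real ^ 'd \<Rightarrow> real" where
  "amari_chentsov \<mu> p is \<theta> =
     (LINT x|\<mu>. (\<Prod>j<length is. partial_deriv (is ! j) (\<lambda>\<theta>'. ln (p x \<theta>')) \<theta>) * p x \<theta>)"

definition fisher_metric ::
    "(real ^ 'd::finite) measure \<Rightarrow> (real ^ 'd \<Rightarrow> real ^ 'd \<Rightarrow> real) \<Rightarrow>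
     real ^ 'd \<Rightarrow> real ^ 'd ^ 'd" where
  "fisher_metric \<mu> p \<theta> =
     (\<chi> i j. - (LINT x|\<mu>. partial_derivs [i, j] (\<lambda>\<theta>'. ln (p x \<theta>')) \<theta> * p x \<theta>))"

definition hessian :: "(real ^ 'd::finite \<Rightarrow> real) \<Rightarrow> real ^ 'd \<Rightarrow> real ^ 'd ^ 'd" where
  "hessian \<psi> \<eta> = (\<chi> i j. partial_derivs [i, j] \<psi> \<eta>)"

definition F1_nat :: "(real ^ 'd::finite) measure \<Rightarrow> real ^ 'd \<Rightarrow> real" where
  "F1_nat \<mu> \<eta> =
    (let \<kappa> = (\<lambda>is. partial_derivs is (log_partition \<mu>) \<eta>);
         \<gamma> = (\<lambda>i j. matrix_inv (hessian (log_partition \<mu>) \<eta>) $ i $ j)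
     in 1 / 8 * (\<Sum>i1\<in>UNIV. \<Sum>i2\<in>UNIV. \<Sum>i3\<in>UNIV. \<Sum>i4\<in>UNIV.
                   \<kappa> [i1, i2, i3, i4] * \<gamma> i1 i2 * \<gamma> i3 i4)
      - 1 / 8 * (\<Sum>i1\<in>UNIV. \<Sum>i2\<in>UNIV. \<Sum>i3\<in>UNIV. \<Sum>i4\<in>UNIV. \<Sum>i5\<in>UNIV. \<Sum>i6\<in>UNIV.
                   \<kappa> [i1, i2, i3] * \<kappa> [i4, i5, i6] * \<gamma> i1 i2 * \<gamma> i3 i4 * \<gamma> i5 i6)
      - 1 / 12 * (\<Sum>i1\<in>UNIV. \<Sum>i2\<in>UNIV. \<Sum>i3\<in>UNIV. \<Sum>i4\<in>UNIV. \<Sum>i5\<in>UNIV. \<Sum>i6\<in>UNIV.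
                   \<kappa> [i1, i2, i3] * \<kappa> [i4, i5, i6] * \<gamma> i1 i4 * \<gamma> i2 i5 * \<gamma> i3 i6))"

definition F1 ::
    "(real ^ 'd::finite) measure \<Rightarrow> (real ^ 'd \<Rightarrow> real ^ 'd) \<Rightarrow> real ^ 'd \<Rightarrow> real" where
  "F1 \<mu> \<eta> \<theta> = F1_nat \<mu> (\<eta> \<theta>)"

end

theory Submission
  imports Defs
begin

text \<open>
  Up to order three the cumulants of an exponential family are the central moments of the carrier
  variable, and \<open>\<kappa>\<^sub>i\<^sub>j\<^sub>k\<^sub>l\<close> is the fourth central moment minus the three pairings of covariances
  \<open>H\<close>; contracted with \<open>H\<^sup>-\<^sup>1\<close>, these pairings give \<open>d\<^sup>2 + d + d\<close>.  The remaining contractions do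
  not depend on the parameterisation: the score is \<open>J\<^sup>T (x - E x)\<close> and the Fisher metric is
  \<open>J\<^sup>T H J\<close>, where \<open>J\<close> is the Jacobian of \<open>\<eta>\<close>.  Writing each contraction as an expectation over one
  or two independent copies \<open>x, z\<close> of a polynomial in the pairing \<open>score(x)\<^sup>T g\<^sup>-\<^sup>1 score(z)\<close>, which equals
  \<open>(x - E x)\<^sup>T H\<^sup>-\<^sup>1 (z - E z)\<close>, makes the invariance pointwise.  Differentiation under the integral
  sign is justified by a quadratic remainder estimate, because the natural parameter space is open.
\<close>

section \<open>Partial derivatives\<close>

text \<open>Chain rule along the line through \<open>x\<close> in direction \<open>axis i 1\<close>.
  It reduces the partial derivatives below to values of a Frechet derivative at basis
  vectors.\<close>

lemma partial_deriv_eq: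
  assumes "(f has_derivative f') (at x)"
  shows "partial_deriv i f x = f' (axis i 1)"
proof -
  interpret bounded_linear f' using assms by (rule has_derivative_bounded_linear)
  have "((\<lambda>t. x + t *\<^sub>R axis i 1) has_derivative (\<lambda>t. t *\<^sub>R axis i (1::real))) (at 0)"
    by (auto intro!: derivative_eq_intros)
  from has_derivative_compose[OF this, of f f'] assms
  have "((\<lambda>t. f (x + t *\<^sub>R axis i 1)) has_derivative (\<lambda>t. t *\<^sub>R f' (axis i 1))) (at 0)"
    by (simp add: scaleR)
  then show ?thesis
    unfolding partial_deriv_def
    by (intro vector_derivative_at) (simp add: has_vector_derivative_def)
qed

text \<open>Points near \<open>x\<close> on the coordinate line stay in \<open>S\<close>. This
  allows an inner derivative to be replaced by a closed form known only on an open set before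
  differentiating again.\<close>

lemma partial_deriv_cong_open:
  assumes "open S" "x \<in> S" "\<And>y. y \<in> S \<Longrightarrow> f y = g y"
  shows "partial_deriv i f x = partial_deriv i g x"
proof -
  have "((\<lambda>t::real. x + t *\<^sub>R axis i 1) \<longlongrightarrow> x + 0 *\<^sub>R axis i 1) (nhds 0)"
    by (intro tendsto_intros filterlim_ident)
  then have "\<forall>\<^sub>F t in nhds (0::real). x + t *\<^sub>R axis i 1 \<in> S"
    using assms(1,2) by (intro topological_tendstoD) auto
  then have "\<forall>\<^sub>F t in nhds (0::real). f (x + t *\<^sub>R axis i 1) = g (x + t *\<^sub>R axis i 1)"
    by eventually_elim (rule assms(3))
  then show ?thesis
    unfolding partial_deriv_def by (intro vector_derivative_cong_eq) auto
qed

section \<open>Differentiation under the integral sign\<close>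

text \<open>Second order Taylor formula with Lagrange remainder; the factor 1/2 is given
  away.\<close>

lemma abs_exp_minus_linear_le: "\<bar>exp s - 1 - s\<bar> \<le> s\<^sup>2 * exp \<bar>s\<bar>" for s :: real
proof -
  obtain t where t: "\<bar>t\<bar> \<le> \<bar>s\<bar>" "exp s = (\<Sum>m<2. s ^ m / fact m) + exp t / fact 2 * s ^ 2"
    using Maclaurin_exp_le[of s 2] by blast
  have "exp t \<le> exp \<bar>s\<bar>" using t(1) by simp
  then have "exp t * s\<^sup>2 \<le> exp \<bar>s\<bar> * s\<^sup>2" by (rule mult_right_mono) simp
  moreover have "exp s - 1 - s = exp t * s\<^sup>2 / 2"
    using t(2) by (simp add: numeral_2_eq_2)
  moreover have "0 \<le> exp t * s\<^sup>2" by simp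
  ultimately show ?thesis by (simp only: mult.commute[of "s\<^sup>2"])
qed

text \<open>Absorbs a linear factor into an exponential of arbitrarily small rate
  \<open>e\<close>.\<close>

lemma le_exp_div: "r \<le> exp (e * r) / e" if "e > 0" for r e :: real
proof -
  have "e * r \<le> exp (e * r)" using exp_ge_add_one_self[of "e * r"] by linarith
  then show ?thesis using that by (simp add: field_simps)
qed

text \<open>This growth class contains the polynomials and is closed under products; on an open natural
  parameter space its members are integrable against every \<open>exp (x \<bullet> \<eta>)\<close>.\<close>

definition subexponential :: "('a::euclidean_space \<Rightarrow> real) \<Rightarrow> bool" where
  "subexponential f \<longleftrightarrow>
     f \<in> borel_measurable borel \<and> (\<forall>e>0. \<exists>C. \<forall>x. \<bar>f x\<bar> \<le> C * exp (e * norm x))"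

lemma subexponential_const [intro, simp]: "subexponential (\<lambda>x. c)"
  unfolding subexponential_def
proof (intro conjI allI impI exI)
  show "\<bar>c\<bar> \<le> \<bar>c\<bar> * exp (e * norm x)" if "e > 0" for e and x :: 'a
    using that mult_left_mono[of 1 "exp (e * norm x)" "\<bar>c\<bar>"] by simp
qed simp

lemma subexponential_inner [intro, simp]: "subexponential (\<lambda>x. x \<bullet> h)"
  unfolding subexponential_def
proof (intro conjI allI impI exI)
  show "\<bar>x \<bullet> h\<bar> \<le> (norm h / e) * exp (e * norm x)" if "e > 0" for e and x :: 'a
  proof -
    have "\<bar>x \<bullet> h\<bar> \<le> norm h * norm x"
      using Cauchy_Schwarz_ineq2[of x h] by (simp add: mult.commute)
    also have "\<dots> \<le> norm h * (exp (e * norm x) / e)"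
      by (intro mult_left_mono le_exp_div that) simp
    finally show ?thesis by simp
  qed
qed simp

lemma subexponential_nth [intro, simp]: "subexponential (\<lambda>x::real^'d. x $ i)"
  using subexponential_inner[of "axis i (1::real)"] by (simp add: inner_axis del: subexponential_inner)

lemma subexponential_mult [intro, simp]:
  assumes "subexponential f" "subexponential g"
  shows "subexponential (\<lambda>x. f x * g x)"
  unfolding subexponential_def
proof (intro conjI allI impI)
  show "(\<lambda>x. f x * g x) \<in> borel_measurable borel"
    using assms by (auto simp: subexponential_def)
  fix e :: real assume "e > 0"
  \<comment> \<open>Half of the rate goes to each factor, so that the product again has rate
    \<open>e\<close>.\<close>
  then have "e / 2 > 0" by simp
  then obtain C D where C: "\<And>x. \<bar>f x\<bar> \<le> C * exp (e / 2 * norm x)"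
    and D: "\<And>x. \<bar>g x\<bar> \<le> D * exp (e / 2 * norm x)"
    using assms unfolding subexponential_def by meson
  have "\<bar>f x * g x\<bar> \<le> (C * D) * exp (e * norm x)" for x
  proof -
    have "\<bar>f x * g x\<bar> \<le> (C * exp (e / 2 * norm x)) * (D * exp (e / 2 * norm x))"
      unfolding abs_mult by (intro mult_mono' C D) auto
    also have "\<dots> = (C * D) * exp (e * norm x)"
      by (simp add: mult_ac flip: exp_add)
    finally show ?thesis .
  qed
  then show "\<exists>C. \<forall>x. \<bar>f x * g x\<bar> \<le> C * exp (e * norm x)" by blast
qed

lemma subexponential_add [intro, simp]:
  assumes "subexponential f" "subexponential g"
  shows "subexponential (\<lambda>x. f x + g x)"
  unfolding subexponential_def
proof (intro conjI allI impI)
  show "(\<lambda>x. f x + g x) \<in> borel_measurable borel"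
    using assms by (auto simp: subexponential_def)
  fix e :: real assume "e > 0"
  then obtain C D where C: "\<And>x. \<bar>f x\<bar> \<le> C * exp (e * norm x)"
    and D: "\<And>x. \<bar>g x\<bar> \<le> D * exp (e * norm x)"
    using assms unfolding subexponential_def by meson
  have "\<bar>f x + g x\<bar> \<le> (C + D) * exp (e * norm x)" for x
    using C[of x] D[of x] by (simp add: algebra_simps)
  then show "\<exists>C. \<forall>x. \<bar>f x + g x\<bar> \<le> C * exp (e * norm x)" by blast
qed

lemma subexponential_diff [intro, simp]:
  assumes "subexponential f" "subexponential g"
  shows "subexponential (\<lambda>x. f x - g x)"
  using subexponential_add[OF assms(1) subexponential_mult[OF subexponential_const[of "-1"] assms(2)]]
  by simp

lemma subexponential_sum [intro, simp]:
  "(\<And>i. i \<in> I \<Longrightarrow> subexponential (f i)) \<Longrightarrow> subexponential (\<lambda>x. \<Sum>i\<in>I. f i x)"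
  by (induction I rule: infinite_finite_induct) auto

section \<open>Exponential moments and Laplace transforms of the carrier measure\<close>

locale nef_carrier =
  fixes \<mu> :: "(real ^ 'd::finite) measure"
  assumes sets_carrier [measurable_cong, simp]: "sets \<mu> = sets borel"
    and open_natural: "open (natural_parameter_space \<mu>)"
    and minimal: "minimal_carrier \<mu>"
begin

abbreviation "N \<equiv> natural_parameter_space \<mu>"

definition expect :: "(real ^ 'd \<Rightarrow> real) \<Rightarrow> real ^ 'd \<Rightarrow> real" where
  "expect f \<eta> = (LINT x|\<mu>. f x * exp (x \<bullet> \<eta> - log_partition \<mu> \<eta>))"

text \<open>The unnormalised counterpart of \<open>expect\<close>. Derivatives are computed here,
  where no normaliser depends on \<eta>, and carried over by \<open>expect_eq\<close>.\<close>

definition laplace :: "(real ^ 'd \<Rightarrow> real) \<Rightarrow> real ^ 'd \<Rightarrow> real" where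
  "laplace f \<eta> = (LINT x|\<mu>. f x * exp (x \<bullet> \<eta>))"

lemma subexponential_measurable [measurable_dest]:
  "subexponential f \<Longrightarrow> f \<in> borel_measurable \<mu>"
  by (simp add: subexponential_def measurable_def sets_eq_imp_space_eq[OF sets_carrier])

lemma integrable_exp: "\<eta> \<in> N \<Longrightarrow> integrable \<mu> (\<lambda>x. exp (x \<bullet> \<eta>))"
  by (simp add: natural_parameter_space_def)

text \<open>Openness leaves room to shift \<eta> by \<open>s\<close> in both directions along every
  coordinate axis without leaving \<open>N\<close>. The integrable exponentials at these finitely
  many points jointly dominate the integrand.\<close>

lemma integrable_exp_norm:
  assumes "\<eta> \<in> N"
  obtains e where "e > 0" "integrable \<mu> (\<lambda>x. exp (e * norm x) * exp (x \<bullet> \<eta>))"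
proof -
  obtain r where r: "r > 0" "ball \<eta> r \<subseteq> N"
    using open_natural assms by (meson openE)
  define s where "s = r / 2"
  \<comment> \<open>The division compensates for the dimension factor in the bound of
    \<open>norm x\<close> by the largest coordinate.\<close>
  define e where "e = s / CARD('d)"
  have s: "0 < s" "s < r" using r by (auto simp: s_def)
  have e: "e > 0" using s by (simp add: e_def)
  have mem: "\<eta> + t *\<^sub>R axis i 1 \<in> N" if "\<bar>t\<bar> = s" for t i
    using r(2) s that by (intro subsetD[OF r(2)]) (simp add: dist_norm)
  have int: "integrable \<mu> (\<lambda>x. \<Sum>i\<in>UNIV. exp (x \<bullet> (\<eta> + s *\<^sub>R axis i 1))
       + exp (x \<bullet> (\<eta> + (- s) *\<^sub>R axis i 1)))"
    using s by (intro Bochner_Integration.integrable_sum Bochner_Integration.integrable_add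
        integrable_exp mem) auto
  have bound: "exp (e * norm x) * exp (x \<bullet> \<eta>) \<le> (\<Sum>i\<in>UNIV. exp (x \<bullet> (\<eta> + s *\<^sub>R axis i 1))
       + exp (x \<bullet> (\<eta> + (- s) *\<^sub>R axis i 1)))" for x :: "real^'d"
  proof -
    \<comment> \<open>For a coordinate \<open>k\<close> of maximal modulus, the two exponentials
      shifted along axis \<open>k\<close> already suffice as a bound.\<close>
    define M where "M = Max (range (\<lambda>i. \<bar>x $ i\<bar>))"
    have "M \<in> range (\<lambda>i. \<bar>x $ i\<bar>)" unfolding M_def by (intro Max_in) auto
    then obtain k where k: "M = \<bar>x $ k\<bar>" by auto
    have "norm x \<le> (\<Sum>i\<in>UNIV. \<bar>x $ i\<bar>)" by (rule norm_le_l1_cart)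
    also have "\<dots> \<le> (\<Sum>i\<in>(UNIV::'d set). M)"
      unfolding M_def by (intro sum_mono Max_ge) auto
    finally have "e * norm x \<le> e * (CARD('d) * \<bar>x $ k\<bar>)"
      using e k by (intro mult_left_mono) auto
    also have "\<dots> = s * \<bar>x $ k\<bar>" by (simp add: e_def)
    finally have "exp (e * norm x) \<le> exp (s * \<bar>x $ k\<bar>)" by simp
    also have "\<dots> \<le> exp (s * x $ k) + exp (- s * x $ k)"
      by (cases "x $ k \<ge> 0") (auto simp: add_increasing add_increasing2)
    finally have "exp (e * norm x) * exp (x \<bullet> \<eta>) \<le> (exp (s * x $ k) + exp (- s * x $ k)) * exp (x \<bullet> \<eta>)"
      by (intro mult_right_mono) auto
    also have "\<dots> = exp (x \<bullet> (\<eta> + s *\<^sub>R axis k 1)) + exp (x \<bullet> (\<eta> + (- s) *\<^sub>R axis k 1))"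
      by (simp add: inner_add_right inner_axis algebra_simps flip: exp_add)
    also have "\<dots> \<le> (\<Sum>i\<in>UNIV. exp (x \<bullet> (\<eta> + s *\<^sub>R axis i 1))
       + exp (x \<bullet> (\<eta> + (- s) *\<^sub>R axis i 1)))"
      by (intro member_le_sum) (auto intro: add_nonneg_nonneg)
    finally show ?thesis .
  qed
  have "integrable \<mu> (\<lambda>x. exp (e * norm x) * exp (x \<bullet> \<eta>))"
    by (rule Bochner_Integration.integrable_bound[OF int])
       (auto intro!: AE_I2 order.trans[OF bound] abs_ge_self)
  with e show ?thesis using that by blast
qed

text \<open>The growth bound holds for every rate, in particular for the one that
  \<open>integrable_exp_norm\<close> provides at \<eta>.\<close>

lemma integrable_subexponential:
  assumes "subexponential f" "\<eta> \<in> N"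
  shows "integrable \<mu> (\<lambda>x. f x * exp (x \<bullet> \<eta>))"
proof -
  obtain e where e: "e > 0" "integrable \<mu> (\<lambda>x. exp (e * norm x) * exp (x \<bullet> \<eta>))"
    using integrable_exp_norm assms(2) by blast
  obtain C where C: "\<And>x. \<bar>f x\<bar> \<le> C * exp (e * norm x)"
    using assms(1) e(1) unfolding subexponential_def by blast
  have "integrable \<mu> (\<lambda>x. C * (exp (e * norm x) * exp (x \<bullet> \<eta>)))"
    using e(2) by (rule integrable_mult_right)
  then show ?thesis
  proof (rule Bochner_Integration.integrable_bound)
    show "(\<lambda>x. f x * exp (x \<bullet> \<eta>)) \<in> borel_measurable \<mu>"
      using assms(1) by measurable
    have "\<bar>f x * exp (x \<bullet> \<eta>)\<bar> \<le> \<bar>C * (exp (e * norm x) * exp (x \<bullet> \<eta>))\<bar>" for x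
    proof -
      have "\<bar>f x * exp (x \<bullet> \<eta>)\<bar> \<le> (C * exp (e * norm x)) * exp (x \<bullet> \<eta>)"
        by (simp add: abs_mult mult_right_mono C)
      then show ?thesis by (simp add: mult.assoc)
    qed
    then show "AE x in \<mu>. norm (f x * exp (x \<bullet> \<eta>)) \<le> norm (C * (exp (e * norm x) * exp (x \<bullet> \<eta>)))"
      by simp
  qed
qed

lemma laplace_add:
  "subexponential f \<Longrightarrow> subexponential g \<Longrightarrow> \<eta> \<in> N \<Longrightarrow>
     laplace (\<lambda>x. f x + g x) \<eta> = laplace f \<eta> + laplace g \<eta>"
  unfolding laplace_def by (simp add: distrib_right integrable_subexponential)

lemma laplace_cmult: "laplace (\<lambda>x. c * f x) \<eta> = c * laplace f \<eta>"
  unfolding laplace_def by (simp add: mult.assoc)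

lemma laplace_sum:
  "(\<And>i. i \<in> I \<Longrightarrow> subexponential (f i)) \<Longrightarrow> \<eta> \<in> N \<Longrightarrow>
     laplace (\<lambda>x. \<Sum>i\<in>I. f i x) \<eta> = (\<Sum>i\<in>I. laplace (f i) \<eta>)"
  unfolding laplace_def by (simp add: sum_distrib_right integrable_subexponential)

text \<open>The candidate derivative differentiates the integrand. What remains is the integral of
  \<open>f x * exp (x \<bullet> \<eta>)\<close> times the second order remainder of
  \<open>exp (x \<bullet> h)\<close>, and it is at most \<open>K\<close> times the square of
  \<open>norm h\<close> for small \<open>h\<close>.\<close>

lemma has_derivative_laplace:
  assumes f: "subexponential f" and \<eta>: "\<eta> \<in> N"
  shows "(laplace f has_derivative (\<lambda>h. laplace (\<lambda>x. f x * (x \<bullet> h)) \<eta>)) (at \<eta>)"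
proof -
  let ?D = "\<lambda>h. laplace (\<lambda>x. f x * (x \<bullet> h)) \<eta>"
  have lin: "linear ?D"
  proof (rule linearI)
    fix a b :: "real^'d" and c :: real
    show "?D (a + b) = ?D a + ?D b"
      using laplace_add[of "\<lambda>x. f x * (x \<bullet> a)" "\<lambda>x. f x * (x \<bullet> b)"] f \<eta>
      by (simp add: inner_add_right distrib_left)
    show "?D (c *\<^sub>R a) = c *\<^sub>R ?D a"
      using laplace_cmult[of c "\<lambda>x. f x * (x \<bullet> a)"] by (simp add: mult_ac)
  qed
  obtain e0 where e0: "e0 > 0" "integrable \<mu> (\<lambda>x. exp (e0 * norm x) * exp (x \<bullet> \<eta>))"
    using integrable_exp_norm \<eta> by blast
  obtain r where r: "r > 0" "ball \<eta> r \<subseteq> N"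
    using open_natural \<eta> by (meson openE)
  \<comment> \<open>Four factors of rate \<open>e\<close> have to fit into rate \<open>e0\<close>:
    one from \<open>f\<close>, two from the square of \<open>norm x\<close>, and one from
    \<open>exp \<bar>x \<bullet> h\<bar>\<close> with \<open>norm h \<le> e\<close>.\<close>
  define e where "e = e0 / 4"
  have e: "e > 0" using e0 by (simp add: e_def)
  obtain C where C: "\<And>x. \<bar>f x\<bar> \<le> C * exp (e * norm x)"
    using f e unfolding subexponential_def by blast
  have C0: "C \<ge> 0" using C[of 0] by simp
  define K where "K = C / e\<^sup>2 * (LINT x|\<mu>. exp (e0 * norm x) * exp (x \<bullet> \<eta>))"
  have bound: "\<bar>laplace f (\<eta> + h) - laplace f \<eta> - ?D h\<bar> \<le> K * (norm h)\<^sup>2"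
    if h: "norm h < r" "norm h \<le> e" for h
  proof -
    have mem: "\<eta> + h \<in> N" using r h by (intro subsetD[OF r(2)]) (simp add: dist_norm)
    have i: "integrable \<mu> (\<lambda>x. f x * exp (x \<bullet> (\<eta> + h)))" "integrable \<mu> (\<lambda>x. f x * exp (x \<bullet> \<eta>))"
      "integrable \<mu> (\<lambda>x. (f x * (x \<bullet> h)) * exp (x \<bullet> \<eta>))"
      using f \<eta> mem by (auto intro!: integrable_subexponential)
    have eq: "f x * exp (x \<bullet> (\<eta> + h)) - f x * exp (x \<bullet> \<eta>) - (f x * (x \<bullet> h)) * exp (x \<bullet> \<eta>)
      = f x * exp (x \<bullet> \<eta>) * (exp (x \<bullet> h) - 1 - x \<bullet> h)" for x
      by (simp add: inner_add_right exp_add algebra_simps)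
    have "laplace f (\<eta> + h) - laplace f \<eta> - ?D h =
      (LINT x|\<mu>. f x * exp (x \<bullet> (\<eta> + h)) - f x * exp (x \<bullet> \<eta>) - (f x * (x \<bullet> h)) * exp (x \<bullet> \<eta>))"
      unfolding laplace_def using i by simp
    also have "\<bar>\<dots>\<bar> \<le> (LINT x|\<mu>. (norm h)\<^sup>2 * (C / e\<^sup>2) * (exp (e0 * norm x) * exp (x \<bullet> \<eta>)))"
    proof (rule integral_abs_bound_integral)
      show "integrable \<mu> (\<lambda>x. f x * exp (x \<bullet> (\<eta> + h)) - f x * exp (x \<bullet> \<eta>) - (f x * (x \<bullet> h)) * exp (x \<bullet> \<eta>))"
        using i by simp
      show "integrable \<mu> (\<lambda>x. (norm h)\<^sup>2 * (C / e\<^sup>2) * (exp (e0 * norm x) * exp (x \<bullet> \<eta>)))"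
        using e0(2) by (rule integrable_mult_right)
      fix x
      have sq: "\<bar>x \<bullet> h\<bar> \<le> norm x * norm h" by (rule Cauchy_Schwarz_ineq2)
      have "norm x \<le> exp (e * norm x) / e" by (intro le_exp_div e)
      then have x2: "(norm x)\<^sup>2 \<le> (exp (e * norm x) / e)\<^sup>2" by (intro power_mono) auto
      have "\<bar>exp (x \<bullet> h) - 1 - x \<bullet> h\<bar> \<le> (x \<bullet> h)\<^sup>2 * exp \<bar>x \<bullet> h\<bar>"
        by (rule abs_exp_minus_linear_le)
      also have "\<dots> \<le> (norm x * norm h)\<^sup>2 * exp (e * norm x)"
      proof (intro mult_mono)
        show "(x \<bullet> h)\<^sup>2 \<le> (norm x * norm h)\<^sup>2" using power_mono[OF sq, of 2] by simp
        have "norm x * norm h \<le> norm x * e" using h by (intro mult_left_mono) auto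
        with sq show "exp \<bar>x \<bullet> h\<bar> \<le> exp (e * norm x)" by (simp add: mult.commute)
      qed auto
      also have "\<dots> \<le> ((exp (e * norm x) / e)\<^sup>2 * (norm h)\<^sup>2) * exp (e * norm x)"
        unfolding power_mult_distrib by (intro mult_right_mono x2) auto
      also have "\<dots> = (norm h)\<^sup>2 / e\<^sup>2 * exp (3 * (e * norm x))"
        by (simp add: power2_eq_square exp_add[symmetric] field_simps)
      finally have R: "\<bar>exp (x \<bullet> h) - 1 - x \<bullet> h\<bar> \<le> (norm h)\<^sup>2 / e\<^sup>2 * exp (3 * (e * norm x))" .
      have "\<bar>f x * exp (x \<bullet> \<eta>) * (exp (x \<bullet> h) - 1 - x \<bullet> h)\<bar>
        \<le> C * exp (e * norm x) * exp (x \<bullet> \<eta>) * ((norm h)\<^sup>2 / e\<^sup>2 * exp (3 * (e * norm x)))"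
        unfolding abs_mult using C0 by (intro mult_mono C R) auto
      also have "\<dots> = (norm h)\<^sup>2 * (C / e\<^sup>2) * (exp (e * norm x) * exp (3 * (e * norm x)) * exp (x \<bullet> \<eta>))"
        by (simp add: mult_ac)
      also have "exp (e * norm x) * exp (3 * (e * norm x)) = exp (e0 * norm x)"
        by (simp add: e_def flip: exp_add)
      finally show "\<bar>f x * exp (x \<bullet> (\<eta> + h)) - f x * exp (x \<bullet> \<eta>) - (f x * (x \<bullet> h)) * exp (x \<bullet> \<eta>)\<bar>
        \<le> (norm h)\<^sup>2 * (C / e\<^sup>2) * (exp (e0 * norm x) * exp (x \<bullet> \<eta>))"
        unfolding eq .
    qed
    also have "\<dots> = K * (norm h)\<^sup>2" by (simp add: K_def)
    finally show ?thesis .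
  qed
  show ?thesis
    unfolding has_derivative_iff_norm
  proof
    show "bounded_linear ?D" using lin by (rule linear_conv_bounded_linear[THEN iffD1])
    show "((\<lambda>y. norm ((laplace f y - laplace f \<eta>) - ?D (y - \<eta>)) / norm (y - \<eta>)) \<longlongrightarrow> 0) (at \<eta>)"
    proof (rule Lim_null_comparison)
      show "\<forall>\<^sub>F y in at \<eta>. norm (norm ((laplace f y - laplace f \<eta>) - ?D (y - \<eta>)) / norm (y - \<eta>))
          \<le> K * norm (y - \<eta>)"
      proof -
        \<comment> \<open>Distance below \<open>r\<close> keeps \<open>y\<close> in
          \<open>N\<close>; distance below \<open>e\<close> controls the rate of the
          remainder.\<close>
        have "\<forall>\<^sub>F y in at \<eta>. dist y \<eta> < min r e \<and> y \<noteq> \<eta>"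
          unfolding eventually_at using r e by (intro exI[of _ "min r e"]) auto
        then show ?thesis
        proof eventually_elim
          case (elim y)
          then have "\<bar>laplace f y - laplace f \<eta> - ?D (y - \<eta>)\<bar> \<le> K * (norm (y - \<eta>))\<^sup>2"
            using bound[of "y - \<eta>"] by (simp add: dist_norm)
          then show ?case using elim by (simp add: divide_le_eq power2_eq_square)
        qed
      qed
      show "((\<lambda>y. K * norm (y - \<eta>)) \<longlongrightarrow> 0) (at \<eta>)"
        by (auto intro!: tendsto_eq_intros)
    qed
  qed
qed

text \<open>The integrand is positive everywhere, so a vanishing integral would leave \<mu>
  supported on the empty set, a proper affine subspace excluded by minimality.\<close>

lemma laplace_pos: "laplace (\<lambda>x. 1) \<eta> > 0" if "\<eta> \<in> N"
proof -
  have "\<not> (AE x in \<mu>. x \<in> {})"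
    using minimal unfolding minimal_carrier_def by (metis affine_empty empty_not_UNIV)
  then have "\<not> (AE x in \<mu>. exp (x \<bullet> \<eta>) = 0)" by simp
  then have "(LINT x|\<mu>. exp (x \<bullet> \<eta>)) \<noteq> 0"
    using integral_nonneg_eq_0_iff_AE[OF integrable_exp[OF that]] by simp
  moreover have "(LINT x|\<mu>. exp (x \<bullet> \<eta>)) \<ge> 0" by (rule Bochner_Integration.integral_nonneg) simp
  ultimately show ?thesis by (auto simp: laplace_def less_le)
qed

section \<open>Expectations under the members of the family\<close>

lemma log_partition_eq: "log_partition \<mu> = (\<lambda>\<eta>. ln (laplace (\<lambda>x. 1) \<eta>))"
  by (simp add: log_partition_def laplace_def fun_eq_iff)

lemma expect_eq: "expect f \<eta> = laplace f \<eta> / laplace (\<lambda>x. 1) \<eta>" if "\<eta> \<in> N"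
proof -
  have "exp (log_partition \<mu> \<eta>) = laplace (\<lambda>x. 1) \<eta>"
    using laplace_pos[OF that] by (simp add: log_partition_eq)
  then show ?thesis unfolding expect_def by (simp add: exp_diff laplace_def)
qed

lemma expect_const [simp]: "\<eta> \<in> N \<Longrightarrow> expect (\<lambda>x. c) \<eta> = c"
  using laplace_pos[of \<eta>] laplace_cmult[of c "\<lambda>x. 1"] by (simp add: expect_eq)

lemma expect_add [simp]:
  "subexponential f \<Longrightarrow> subexponential g \<Longrightarrow> \<eta> \<in> N \<Longrightarrow>
     expect (\<lambda>x. f x + g x) \<eta> = expect f \<eta> + expect g \<eta>"
  by (simp add: expect_eq laplace_add add_divide_distrib)

lemma expect_cmult [simp]: "expect (\<lambda>x. c * f x) \<eta> = c * expect f \<eta>"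
  by (simp add: expect_def mult.assoc)

lemma expect_diff [simp]:
  "subexponential f \<Longrightarrow> subexponential g \<Longrightarrow> \<eta> \<in> N \<Longrightarrow>
     expect (\<lambda>x. f x - g x) \<eta> = expect f \<eta> - expect g \<eta>"
  using expect_add[of f "\<lambda>x. -1 * g x"] expect_cmult[of "-1" g]
    subexponential_mult[OF subexponential_const[of "-1"], of g] by simp

lemma expect_sum [simp]:
  "(\<And>i. i \<in> I \<Longrightarrow> subexponential (f i)) \<Longrightarrow> \<eta> \<in> N \<Longrightarrow>
     expect (\<lambda>x. \<Sum>i\<in>I. f i x) \<eta> = (\<Sum>i\<in>I. expect (f i) \<eta>)"
  by (simp add: expect_eq laplace_sum sum_divide_distrib)

text \<open>Quotient rule for \<open>expect_eq\<close>. The derivative in direction \<open>h\<close>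
  is the covariance of \<open>f x\<close> and \<open>x \<bullet> h\<close>; repeated use of this
  rule generates the higher cumulants.\<close>

lemma has_derivative_expect:
  assumes "subexponential f" "\<eta> \<in> N"
  shows "(expect f has_derivative
     (\<lambda>h. expect (\<lambda>x. f x * (x \<bullet> h)) \<eta> - expect f \<eta> * expect (\<lambda>x. x \<bullet> h) \<eta>)) (at \<eta>)"
proof -
  have Z: "laplace (\<lambda>x. 1) \<eta> \<noteq> 0" using laplace_pos[OF assms(2)] by simp
  have "((\<lambda>\<eta>. laplace f \<eta> / laplace (\<lambda>x. 1) \<eta>) has_derivative
     (\<lambda>h. expect (\<lambda>x. f x * (x \<bullet> h)) \<eta> - expect f \<eta> * expect (\<lambda>x. x \<bullet> h) \<eta>)) (at \<eta>)"
    using has_derivative_divide'[OF has_derivative_laplace[OF assms]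
        has_derivative_laplace[OF subexponential_const[of 1] assms(2)] Z]
    by (rule has_derivative_eq_rhs) (use Z assms(2) in \<open>auto simp: expect_eq field_simps\<close>)
  then show ?thesis
    by (rule has_derivative_transform_within_open[OF _ open_natural assms(2)])
       (simp add: expect_eq)
qed

text \<open>The logarithmic derivative of the normaliser is the mean of
  \<open>x \<bullet> h\<close>.\<close>

lemma has_derivative_log_partition:
  assumes "\<eta> \<in> N"
  shows "(log_partition \<mu> has_derivative (\<lambda>h. expect (\<lambda>x. x \<bullet> h) \<eta>)) (at \<eta>)"
  unfolding log_partition_eq
  using has_derivative_ln[OF laplace_pos[OF assms] has_derivative_laplace[OF subexponential_const[of 1] assms]]
  by (rule has_derivative_eq_rhs) (use assms in \<open>auto simp: expect_eq divide_inverse\<close>)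


section \<open>Cumulants and central moments\<close>

lemma partial_deriv_log_partition [simp]:
  "\<eta> \<in> N \<Longrightarrow> partial_deriv i (log_partition \<mu>) \<eta> = expect (\<lambda>x. x $ i) \<eta>"
  by (simp add: partial_deriv_eq[OF has_derivative_log_partition] inner_axis)

lemmas has_derivative_mean = has_derivative_expect[OF subexponential_nth]

definition central2 :: "'d \<Rightarrow> 'd \<Rightarrow> real ^ 'd \<Rightarrow> real" where
  "central2 i j \<eta> = expect (\<lambda>x. (x $ i - expect (\<lambda>y. y $ i) \<eta>) * (x $ j - expect (\<lambda>y. y $ j) \<eta>)) \<eta>"

definition central3 :: "'d \<Rightarrow> 'd \<Rightarrow> 'd \<Rightarrow> real ^ 'd \<Rightarrow> real" where
  "central3 i j k \<eta> = expect (\<lambda>x. (x $ i - expect (\<lambda>y. y $ i) \<eta>) *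
     (x $ j - expect (\<lambda>y. y $ j) \<eta>) * (x $ k - expect (\<lambda>y. y $ k) \<eta>)) \<eta>"

definition central4 :: "'d \<Rightarrow> 'd \<Rightarrow> 'd \<Rightarrow> 'd \<Rightarrow> real ^ 'd \<Rightarrow> real" where
  "central4 i j k l \<eta> = expect (\<lambda>x. (x $ i - expect (\<lambda>y. y $ i) \<eta>) *
     (x $ j - expect (\<lambda>y. y $ j) \<eta>) * (x $ k - expect (\<lambda>y. y $ k) \<eta>) *
     (x $ l - expect (\<lambda>y. y $ l) \<eta>)) \<eta>"

text \<open>The centred integrand itself varies with \<eta>. Raw moments have fixed integrands, so
  \<open>has_derivative_expect\<close> applies to them; this and the next two expansions prepare for
  that.\<close>

lemma central2_raw:
  assumes "\<eta> \<in> N"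
  shows "central2 i j \<eta> = expect (\<lambda>x. x $ i * x $ j) \<eta> - expect (\<lambda>x. x $ i) \<eta> * expect (\<lambda>x. x $ j) \<eta>"
proof -
  \<comment> \<open>The means are written to the left of the coordinates, which lets
    \<open>expect_cmult\<close> pull them out; likewise in the two expansions below.\<close>
  have *: "(u - a) * (v - b) = u * v - a * v - b * u + a * b" for u v a b :: real
    by (simp add: algebra_simps)
  show ?thesis unfolding central2_def * using assms by simp
qed

lemma central3_raw:
  assumes "\<eta> \<in> N"
  defines "m i \<equiv> expect (\<lambda>x. x $ i) \<eta>"
  defines "m2 i j \<equiv> expect (\<lambda>x. x $ i * x $ j) \<eta>"
  shows "central3 i j k \<eta> = expect (\<lambda>x. x $ i * x $ j * x $ k) \<eta>
    - m i * m2 j k - m j * m2 i k - m k * m2 i j + 2 * m i * m j * m k"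
proof -
  have *: "(u - a) * (v - b) * (w - c) = u * v * w - a * (v * w) - b * (u * w) - c * (u * v)
     + (a * b) * w + (a * c) * v + (b * c) * u - a * b * c" for u v w a b c :: real
    by (simp add: algebra_simps)
  show ?thesis unfolding central3_def * using assms(1) by (simp add: m_def m2_def)
qed

text \<open>The coefficient -3 arises as 1 from the product of the four means minus 4 from the terms
  with a single coordinate left. At order three the same count gives 3 - 1 = 2.\<close>

lemma central4_raw:
  assumes "\<eta> \<in> N"
  defines "m i \<equiv> expect (\<lambda>x. x $ i) \<eta>"
  defines "m2 i j \<equiv> expect (\<lambda>x. x $ i * x $ j) \<eta>"
  defines "m3 i j k \<equiv> expect (\<lambda>x. x $ i * x $ j * x $ k) \<eta>"
  shows "central4 i j k l \<eta> = expect (\<lambda>x. x $ i * x $ j * x $ k * x $ l) \<eta>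
    - m i * m3 j k l - m j * m3 i k l - m k * m3 i j l - m l * m3 i j k
    + m i * m j * m2 k l + m i * m k * m2 j l + m i * m l * m2 j k
    + m j * m k * m2 i l + m j * m l * m2 i k + m k * m l * m2 i j
    - 3 * m i * m j * m k * m l"
proof -
  have *: "(u - a) * (v - b) * (w - c) * (z - d) = u * v * w * z
     - a * (v * w * z) - b * (u * w * z) - c * (u * v * z) - d * (u * v * w)
     + (a * b) * (w * z) + (a * c) * (v * z) + (a * d) * (v * w)
     + (b * c) * (u * z) + (b * d) * (u * w) + (c * d) * (u * v)
     - (b * c * d) * u - (a * c * d) * v - (a * b * d) * w - (a * b * c) * z
     + a * b * c * d" for u v w z a b c d :: real
    by (simp add: algebra_simps)
  show ?thesis unfolding central4_def * using assms(1) by (simp add: m_def m2_def m3_def)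
qed

lemma central2_commute: "central2 i j \<eta> = central2 j i \<eta>"
  by (simp add: central2_def mult.commute)

lemma cumulant2:
  assumes "\<eta> \<in> N"
  shows "partial_derivs [i, j] (log_partition \<mu>) \<eta> = central2 i j \<eta>"
proof -
  have "partial_derivs [i, j] (log_partition \<mu>) \<eta> = partial_deriv i (expect (\<lambda>x. x $ j)) \<eta>"
    by (simp, rule partial_deriv_cong_open[OF open_natural assms]) simp
  also have "\<dots> = central2 i j \<eta>"
    using assms by (simp add: partial_deriv_eq[OF has_derivative_mean] inner_axis central2_raw mult_ac)
  finally show ?thesis .
qed

text \<open>Differentiating the raw form of the covariance reproduces the raw form of the third
  central moment, with no correction term.\<close>

lemma cumulant3:
  assumes "\<eta> \<in> N"
  shows "partial_derivs [i, j, k] (log_partition \<mu>) \<eta> = central3 i j k \<eta>"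
proof -
  have "partial_derivs [i, j, k] (log_partition \<mu>) \<eta> = partial_deriv i
      (\<lambda>\<eta>. expect (\<lambda>x. x $ j * x $ k) \<eta> - expect (\<lambda>x. x $ j) \<eta> * expect (\<lambda>x. x $ k) \<eta>) \<eta>"
    unfolding partial_derivs.simps(2)[of i]
    by (rule partial_deriv_cong_open[OF open_natural assms]) (simp only: cumulant2 central2_raw)
  also have "\<dots> = central3 i j k \<eta>"
    by (rule trans, rule partial_deriv_eq, (rule derivative_intros has_derivative_expect
          subexponential_nth subexponential_mult assms)+)
       (use assms in \<open>simp add: inner_axis central3_raw algebra_simps\<close>)
  finally show ?thesis .
qed

text \<open>The means inside the third central moment also move with \<eta>. Their derivatives are
  covariances, and multiplied by the covariance of the other two coordinates they form the three
  subtracted pairings.\<close>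

lemma cumulant4:
  assumes "\<eta> \<in> N"
  shows "partial_derivs [i, j, k, l] (log_partition \<mu>) \<eta> = central4 i j k l \<eta>
    - central2 i j \<eta> * central2 k l \<eta> - central2 i k \<eta> * central2 j l \<eta>
    - central2 i l \<eta> * central2 j k \<eta>"
proof -
  define m where "m i = expect (\<lambda>x. x $ i)" for i
  define m2 where "m2 i j = expect (\<lambda>x. x $ i * x $ j)" for i j
  define m3 where "m3 i j k = expect (\<lambda>x. x $ i * x $ j * x $ k)" for i j k
  have raw: "central3 j k l \<eta> = m3 j k l \<eta> - m j \<eta> * m2 k l \<eta> - m k \<eta> * m2 j l \<eta>
     - m l \<eta> * m2 j k \<eta> + 2 * m j \<eta> * m k \<eta> * m l \<eta>" if "\<eta> \<in> N" for \<eta>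
    using central3_raw[OF that] by (simp add: m_def m2_def m3_def)
  \<comment> \<open>By \<open>has_derivative_expect\<close>, \<open>D f\<close> is the derivative at
    \<eta> of the expectation of \<open>f\<close>. Together with the names for raw moments it keeps
    the long polynomial readable for the derivative rules.\<close>
  define D where "D f h = expect (\<lambda>x. f x * (x \<bullet> h)) \<eta> - expect f \<eta> * expect (\<lambda>x. x \<bullet> h) \<eta>" for f h
  have d: "(m i has_derivative D (\<lambda>x. x $ i)) (at \<eta>)"
    "(m2 i j has_derivative D (\<lambda>x. x $ i * x $ j)) (at \<eta>)"
    "(m3 i j k has_derivative D (\<lambda>x. x $ i * x $ j * x $ k)) (at \<eta>)" for i j k
    using assms unfolding m_def m2_def m3_def D_def by (auto intro!: has_derivative_expect)
  have "partial_derivs [i, j, k, l] (log_partition \<mu>) \<eta> = partial_deriv i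
      (\<lambda>\<eta>. m3 j k l \<eta> - m j \<eta> * m2 k l \<eta> - m k \<eta> * m2 j l \<eta>
     - m l \<eta> * m2 j k \<eta> + 2 * m j \<eta> * m k \<eta> * m l \<eta>) \<eta>"
    unfolding partial_derivs.simps(2)[of i]
    by (rule partial_deriv_cong_open[OF open_natural assms]) (simp only: cumulant3 raw)
  also have "\<dots> = central4 i j k l \<eta>
    - central2 i j \<eta> * central2 k l \<eta> - central2 i k \<eta> * central2 j l \<eta>
    - central2 i l \<eta> * central2 j k \<eta>"
    by (rule trans, rule partial_deriv_eq, (rule derivative_intros d)+)
       (use assms in \<open>simp add: inner_axis central4_raw central2_raw D_def m_def m2_def m3_def algebra_simps\<close>)
  finally show ?thesis .
qed

section \<open>Contractions as expectations\<close>

text \<open>Multiplying out the square of \<open>q x x\<close> and exchanging sums with the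
  expectation gives the contraction. The functions \<open>y\<close> and coefficients
  \<open>G\<close> stay arbitrary, to cover both the scores with the inverse Fisher metric and the
  centred coordinates with the inverse Hessian.\<close>

lemma expect_contract4:
  fixes y :: "'i::finite \<Rightarrow> real ^ 'd \<Rightarrow> real" and G :: "'i \<Rightarrow> 'i \<Rightarrow> real"
  assumes y: "\<And>i. subexponential (y i)" and \<eta>: "\<eta> \<in> N"
  defines "q x z \<equiv> \<Sum>i\<in>UNIV. \<Sum>j\<in>UNIV. y i x * y j z * G i j"
  shows "(\<Sum>i1\<in>UNIV. \<Sum>i2\<in>UNIV. \<Sum>i3\<in>UNIV. \<Sum>i4\<in>UNIV.
           expect (\<lambda>x. y i1 x * y i2 x * y i3 x * y i4 x) \<eta> * G i1 i2 * G i3 i4)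
       = expect (\<lambda>x. q x x * q x x) \<eta>"
proof -
  have "q x x * q x x = (\<Sum>i1\<in>UNIV. \<Sum>i2\<in>UNIV. \<Sum>i3\<in>UNIV. \<Sum>i4\<in>UNIV.
      (G i1 i2 * G i3 i4) * (y i1 x * y i2 x * y i3 x * y i4 x))" for x
    unfolding q_def mult.assoc
    by (simp only: sum_distrib_right, simp only: sum_distrib_left, simp add: mult_ac)
  then show ?thesis using y \<eta> by (simp add: mult_ac)
qed

text \<open>Indices 1 to 3 belong to the copy \<open>x\<close> and 4 to 6 to the copy
  \<open>z\<close>. In the first contraction the three coefficients link \<open>x\<close> to
  \<open>x\<close>, \<open>x\<close> to \<open>z\<close> and \<open>z\<close> to \<open>z\<close>;
  in the second all three link \<open>x\<close> to \<open>z\<close>.\<close>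

lemma expect_contract33:
  fixes y :: "'i::finite \<Rightarrow> real ^ 'd \<Rightarrow> real" and G :: "'i \<Rightarrow> 'i \<Rightarrow> real"
  assumes y: "\<And>i. subexponential (y i)" and \<eta>: "\<eta> \<in> N"
  defines "q x z \<equiv> \<Sum>i\<in>UNIV. \<Sum>j\<in>UNIV. y i x * y j z * G i j"
  shows "(\<Sum>i1\<in>UNIV. \<Sum>i2\<in>UNIV. \<Sum>i3\<in>UNIV. \<Sum>i4\<in>UNIV. \<Sum>i5\<in>UNIV. \<Sum>i6\<in>UNIV.
           expect (\<lambda>x. y i1 x * y i2 x * y i3 x) \<eta> * expect (\<lambda>x. y i4 x * y i5 x * y i6 x) \<eta>
           * G i1 i2 * G i3 i4 * G i5 i6)
       = expect (\<lambda>x. expect (\<lambda>z. q x x * q x z * q z z) \<eta>) \<eta>"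
    and "(\<Sum>i1\<in>UNIV. \<Sum>i2\<in>UNIV. \<Sum>i3\<in>UNIV. \<Sum>i4\<in>UNIV. \<Sum>i5\<in>UNIV. \<Sum>i6\<in>UNIV.
           expect (\<lambda>x. y i1 x * y i2 x * y i3 x) \<eta> * expect (\<lambda>x. y i4 x * y i5 x * y i6 x) \<eta>
           * G i1 i4 * G i2 i5 * G i3 i6)
       = expect (\<lambda>x. expect (\<lambda>z. q x z * q x z * q x z) \<eta>) \<eta>"
proof -
  \<comment> \<open>For arbitrary coefficients the iterated expectation factorises: the inner one
    acts on the \<open>z\<close> factor, and what is left is linear in the \<open>x\<close>
    factor.\<close>
  have aux: "expect (\<lambda>x. expect (\<lambda>z. \<Sum>i1\<in>UNIV. \<Sum>i2\<in>UNIV. \<Sum>i3\<in>UNIV. \<Sum>i4\<in>UNIV. \<Sum>i5\<in>UNIV. \<Sum>i6\<in>UNIV.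
        C i1 i2 i3 i4 i5 i6 * (y i1 x * y i2 x * y i3 x) * (y i4 z * y i5 z * y i6 z)) \<eta>) \<eta>
    = (\<Sum>i1\<in>UNIV. \<Sum>i2\<in>UNIV. \<Sum>i3\<in>UNIV. \<Sum>i4\<in>UNIV. \<Sum>i5\<in>UNIV. \<Sum>i6\<in>UNIV.
        C i1 i2 i3 i4 i5 i6 * expect (\<lambda>x. y i1 x * y i2 x * y i3 x) \<eta> *
        expect (\<lambda>z. y i4 z * y i5 z * y i6 z) \<eta>)" for C
  proof -
    have "expect (\<lambda>z. \<Sum>i1\<in>UNIV. \<Sum>i2\<in>UNIV. \<Sum>i3\<in>UNIV. \<Sum>i4\<in>UNIV. \<Sum>i5\<in>UNIV. \<Sum>i6\<in>UNIV.
        C i1 i2 i3 i4 i5 i6 * (y i1 x * y i2 x * y i3 x) * (y i4 z * y i5 z * y i6 z)) \<eta>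
      = (\<Sum>i1\<in>UNIV. \<Sum>i2\<in>UNIV. \<Sum>i3\<in>UNIV. \<Sum>i4\<in>UNIV. \<Sum>i5\<in>UNIV. \<Sum>i6\<in>UNIV.
        (C i1 i2 i3 i4 i5 i6 * expect (\<lambda>z. y i4 z * y i5 z * y i6 z) \<eta>) * (y i1 x * y i2 x * y i3 x))"
      for x using y \<eta> by simp (simp add: mult_ac)
    then show ?thesis using y \<eta> by simp (simp add: mult_ac)
  qed
  have "q x x * q x z * q z z = (\<Sum>i1\<in>UNIV. \<Sum>i2\<in>UNIV. \<Sum>i3\<in>UNIV. \<Sum>i4\<in>UNIV. \<Sum>i5\<in>UNIV. \<Sum>i6\<in>UNIV.
      (G i1 i2 * G i3 i4 * G i5 i6) * (y i1 x * y i2 x * y i3 x) * (y i4 z * y i5 z * y i6 z))" for x z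
    unfolding q_def mult.assoc
    by (simp only: sum_distrib_right, simp only: sum_distrib_left, simp add: mult_ac)
  then show "(\<Sum>i1\<in>UNIV. \<Sum>i2\<in>UNIV. \<Sum>i3\<in>UNIV. \<Sum>i4\<in>UNIV. \<Sum>i5\<in>UNIV. \<Sum>i6\<in>UNIV.
           expect (\<lambda>x. y i1 x * y i2 x * y i3 x) \<eta> * expect (\<lambda>x. y i4 x * y i5 x * y i6 x) \<eta>
           * G i1 i2 * G i3 i4 * G i5 i6)
       = expect (\<lambda>x. expect (\<lambda>z. q x x * q x z * q z z) \<eta>) \<eta>"
    by (simp add: aux) (simp add: mult_ac)
  have "q x z * q x z * q x z = (\<Sum>i1\<in>UNIV. \<Sum>i4\<in>UNIV. \<Sum>i2\<in>UNIV. \<Sum>i5\<in>UNIV. \<Sum>i3\<in>UNIV. \<Sum>i6\<in>UNIV.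
      (G i1 i4 * G i2 i5 * G i3 i6) * (y i1 x * y i2 x * y i3 x) * (y i4 z * y i5 z * y i6 z))" for x z
    unfolding q_def mult.assoc
    by (simp only: sum_distrib_right, simp only: sum_distrib_left, simp add: mult_ac)
  \<comment> \<open>The expansion lists the indices pair by pair, as 1 4 2 5 3 6; finite sums are
    swapped to reach the natural order.\<close>
  also have "(\<Sum>i1\<in>UNIV. \<Sum>i4\<in>UNIV. \<Sum>i2\<in>UNIV. \<Sum>i5\<in>UNIV. \<Sum>i3\<in>UNIV. \<Sum>i6\<in>UNIV. f i1 i2 i3 i4 i5 i6)
    = (\<Sum>i1\<in>UNIV. \<Sum>i2\<in>UNIV. \<Sum>i3\<in>UNIV. \<Sum>i4\<in>UNIV. \<Sum>i5\<in>UNIV. \<Sum>i6\<in>UNIV. f i1 i2 i3 i4 i5 i6)"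
    for f :: "'i \<Rightarrow> 'i \<Rightarrow> 'i \<Rightarrow> 'i \<Rightarrow> 'i \<Rightarrow> 'i \<Rightarrow> real"
  proof (rule sum.cong[OF refl])
    fix i1
    have "(\<Sum>i4\<in>UNIV. \<Sum>i2\<in>UNIV. \<Sum>i5\<in>UNIV. \<Sum>i3\<in>UNIV. \<Sum>i6\<in>UNIV. f i1 i2 i3 i4 i5 i6)
      = (\<Sum>i2\<in>UNIV. \<Sum>i4\<in>UNIV. \<Sum>i3\<in>UNIV. \<Sum>i5\<in>UNIV. \<Sum>i6\<in>UNIV. f i1 i2 i3 i4 i5 i6)"
      by (subst sum.swap) (intro sum.cong refl sum.swap)
    also have "\<dots> = (\<Sum>i2\<in>UNIV. \<Sum>i3\<in>UNIV. \<Sum>i4\<in>UNIV. \<Sum>i5\<in>UNIV. \<Sum>i6\<in>UNIV. f i1 i2 i3 i4 i5 i6)"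
      by (intro sum.cong refl sum.swap)
    finally show "(\<Sum>i4\<in>UNIV. \<Sum>i2\<in>UNIV. \<Sum>i5\<in>UNIV. \<Sum>i3\<in>UNIV. \<Sum>i6\<in>UNIV. f i1 i2 i3 i4 i5 i6)
      = (\<Sum>i2\<in>UNIV. \<Sum>i3\<in>UNIV. \<Sum>i4\<in>UNIV. \<Sum>i5\<in>UNIV. \<Sum>i6\<in>UNIV. f i1 i2 i3 i4 i5 i6)" .
  qed
  finally show "(\<Sum>i1\<in>UNIV. \<Sum>i2\<in>UNIV. \<Sum>i3\<in>UNIV. \<Sum>i4\<in>UNIV. \<Sum>i5\<in>UNIV. \<Sum>i6\<in>UNIV.
           expect (\<lambda>x. y i1 x * y i2 x * y i3 x) \<eta> * expect (\<lambda>x. y i4 x * y i5 x * y i6 x) \<eta>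
           * G i1 i4 * G i2 i5 * G i3 i6)
       = expect (\<lambda>x. expect (\<lambda>z. q x z * q x z * q x z) \<eta>) \<eta>"
    by (simp add: aux) (simp add: mult_ac)
qed

end

section \<open>Matrices and Jacobians\<close>

lemma matrix_inv:
  assumes "invertible A"
  shows matrix_inv_right: "A ** matrix_inv A = mat 1" and matrix_inv_left: "matrix_inv A ** A = mat 1"
proof -
  have "A ** matrix_inv A = mat 1 \<and> matrix_inv A ** A = mat 1"
    using assms unfolding invertible_def matrix_inv_def by (rule someI_ex)
  then show "A ** matrix_inv A = mat 1" "matrix_inv A ** A = mat 1" by auto
qed

lemma matrix_inv_unique:
  fixes A B :: "real ^ 'n ^ 'n"
  assumes "A ** B = mat 1"
  shows "matrix_inv A = B"
proof -
  have "invertible A" using assms by (auto simp: invertible_right_inverse)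
  then have "matrix_inv A ** (A ** B) = B"
    by (simp add: matrix_mul_assoc matrix_inv_left)
  then show ?thesis using assms by simp
qed

text \<open>Transformation law of an inverse metric under a change of coordinates with Jacobian
  \<open>J\<close>.\<close>

lemma congruence_matrix_inv:
  fixes H J :: "real ^ 'n ^ 'n"
  assumes "invertible H" "invertible J"
  shows "J ** matrix_inv (transpose J ** H ** J) ** transpose J = matrix_inv H"
proof -
  define G where "G = matrix_inv (transpose J ** H ** J)"
  have "invertible (transpose J ** H ** J)"
    using assms by (intro invertible_mult transpose_invertible)
  then have "(transpose J ** H ** J) ** G = mat 1" unfolding G_def by (rule matrix_inv_right)
  \<comment> \<open>Multiplying by \<open>transpose J\<close> on the right makes this factor appear
    on both sides, where it can be cancelled from the left.\<close>
  then have "transpose J ** (H ** (J ** G ** transpose J)) = transpose J"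
    by (metis matrix_mul_assoc matrix_mul_lid)
  moreover have "matrix_inv (transpose J) ** transpose J = mat 1"
    using assms by (intro matrix_inv_left transpose_invertible)
  ultimately have "H ** (J ** G ** transpose J) = mat 1"
    by (metis matrix_mul_assoc matrix_mul_lid)
  then show ?thesis unfolding G_def by (rule matrix_inv_unique[symmetric])
qed

text \<open>The pairing (12)(34) closes into two traces of the identity and contributes the square
  of the dimension. Each of the other two closes into a single trace and contributes the dimension
  once.\<close>

lemma sum_metric_pairings:
  fixes H \<gamma> :: "real ^ 'n ^ 'n"
  assumes inv: "\<gamma> ** H = mat 1" and sym: "transpose H = H"
  shows "(\<Sum>i1\<in>UNIV. \<Sum>i2\<in>UNIV. \<Sum>i3\<in>UNIV. \<Sum>i4\<in>UNIV.
     (H $ i1 $ i2 * H $ i3 $ i4 + H $ i1 $ i3 * H $ i2 $ i4 + H $ i1 $ i4 * H $ i2 $ i3)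
       * \<gamma> $ i1 $ i2 * \<gamma> $ i3 $ i4) = (real CARD('n))\<^sup>2 + 2 * real CARD('n)"
proof -
  have sym': "H $ i $ j = H $ j $ i" for i j
    using sym by (metis transpose_def vec_lambda_beta)
  have row: "(\<Sum>k\<in>UNIV. \<gamma> $ i $ k * H $ k $ j) = (if i = j then 1 else 0)" for i j
    using arg_cong[OF inv, of "\<lambda>A. A $ i $ j"] by (simp add: matrix_matrix_mult_def mat_def)
  have row': "(\<Sum>k\<in>UNIV. \<gamma> $ i $ k * H $ j $ k) = (if i = j then 1 else 0)" for i j
    using row[of i j] by (simp add: sym')
  have "(\<Sum>i1\<in>UNIV. \<Sum>i2\<in>UNIV. \<Sum>i3\<in>UNIV. \<Sum>i4\<in>UNIV.
      H $ i1 $ i2 * H $ i3 $ i4 * \<gamma> $ i1 $ i2 * \<gamma> $ i3 $ i4)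
    = (\<Sum>i1\<in>UNIV. \<Sum>i2\<in>UNIV. \<gamma> $ i1 $ i2 * H $ i1 $ i2 * (\<Sum>i3\<in>UNIV. \<Sum>i4\<in>UNIV. \<gamma> $ i3 $ i4 * H $ i3 $ i4))"
    by (simp add: sum_distrib_left mult_ac)
  also have "\<dots> = (real CARD('n))\<^sup>2"
    by (simp add: row' power2_eq_square flip: sum_distrib_right)
  finally have 1: "(\<Sum>i1\<in>UNIV. \<Sum>i2\<in>UNIV. \<Sum>i3\<in>UNIV. \<Sum>i4\<in>UNIV.
      H $ i1 $ i2 * H $ i3 $ i4 * \<gamma> $ i1 $ i2 * \<gamma> $ i3 $ i4) = (real CARD('n))\<^sup>2" .
  have "(\<Sum>i1\<in>UNIV. \<Sum>i2\<in>UNIV. \<Sum>i3\<in>UNIV. \<Sum>i4\<in>UNIV.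
      H $ i1 $ i3 * H $ i2 $ i4 * \<gamma> $ i1 $ i2 * \<gamma> $ i3 $ i4)
    = (\<Sum>i1\<in>UNIV. \<Sum>i2\<in>UNIV. \<Sum>i3\<in>UNIV. \<gamma> $ i1 $ i2 * H $ i1 $ i3 * (\<Sum>i4\<in>UNIV. \<gamma> $ i3 $ i4 * H $ i2 $ i4))"
    by (simp add: sum_distrib_left mult_ac)
  also have "\<dots> = CARD('n)" by (simp add: row' if_distrib cong: if_cong)
  finally have 2: "(\<Sum>i1\<in>UNIV. \<Sum>i2\<in>UNIV. \<Sum>i3\<in>UNIV. \<Sum>i4\<in>UNIV.
      H $ i1 $ i3 * H $ i2 $ i4 * \<gamma> $ i1 $ i2 * \<gamma> $ i3 $ i4) = CARD('n)" .
  have "(\<Sum>i1\<in>UNIV. \<Sum>i2\<in>UNIV. \<Sum>i3\<in>UNIV. \<Sum>i4\<in>UNIV.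
      H $ i1 $ i4 * H $ i2 $ i3 * \<gamma> $ i1 $ i2 * \<gamma> $ i3 $ i4)
    = (\<Sum>i1\<in>UNIV. \<Sum>i2\<in>UNIV. \<Sum>i3\<in>UNIV. \<gamma> $ i1 $ i2 * H $ i2 $ i3 * (\<Sum>i4\<in>UNIV. \<gamma> $ i3 $ i4 * H $ i1 $ i4))"
    by (simp add: sum_distrib_left mult_ac)
  also have "\<dots> = CARD('n)" by (simp add: row' row if_distrib cong: if_cong)
  finally have 3: "(\<Sum>i1\<in>UNIV. \<Sum>i2\<in>UNIV. \<Sum>i3\<in>UNIV. \<Sum>i4\<in>UNIV.
      H $ i1 $ i4 * H $ i2 $ i3 * \<gamma> $ i1 $ i2 * \<gamma> $ i3 $ i4) = CARD('n)" .
  show ?thesis by (simp only: distrib_right sum.distrib 1 2 3)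
qed

text \<open>The chain rule for the inverse map composed with \<phi>, which is the identity on the
  open set \<open>S\<close>, yields a left inverse of the Jacobian.\<close>

lemma jacobian_invertible:
  fixes \<phi> :: "real ^ 'n \<Rightarrow> real ^ 'n"
  assumes "diffeomorphism_between S T \<phi>" "\<theta> \<in> S"
  shows "invertible (\<chi> a i. partial_deriv i \<phi> \<theta> $ a)"
proof -
  have S: "open S" "bij_betw \<phi> S T" and smooth: "smooth_on S \<phi>" "smooth_on T (inv_into S \<phi>)"
    using assms unfolding diffeomorphism_between_def by auto
  \<comment> \<open>The empty index list in \<open>smooth_on\<close> is differentiability of the map
    itself.\<close>
  have d: "\<phi> differentiable at \<theta>"
    using smooth(1) assms(2) unfolding smooth_on_def by (auto dest: spec[of _ "[]"])
  have d': "inv_into S \<phi> differentiable at (\<phi> \<theta>)"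
    using smooth(2) bij_betw_apply[OF S(2) assms(2)] unfolding smooth_on_def
    by (auto dest: spec[of _ "[]"])
  obtain D D' where D: "(\<phi> has_derivative D) (at \<theta>)"
    and D': "(inv_into S \<phi> has_derivative D') (at (\<phi> \<theta>))"
    using d d' unfolding differentiable_def by blast
  have "((\<lambda>t. inv_into S \<phi> (\<phi> t)) has_derivative (\<lambda>h. D' (D h))) (at \<theta>)"
    using has_derivative_compose[OF D D'] .
  then have "((\<lambda>t. t) has_derivative (\<lambda>h. D' (D h))) (at \<theta>)"
    by (rule has_derivative_transform_within_open[OF _ S(1) assms(2)])
       (use S(2) in \<open>simp add: bij_betw_inv_into_left\<close>)
  then have id: "(\<lambda>h. D' (D h)) = (\<lambda>h. h)"
    by (rule has_derivative_unique) (rule has_derivative_ident)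
  have lin: "linear D" "linear D'"
    using D D' has_derivative_linear by blast+
  have "(\<chi> a i. partial_deriv i \<phi> \<theta> $ a) = matrix D"
    by (simp add: partial_deriv_eq[OF D] matrix_def)
  moreover have "matrix D' ** matrix D = mat 1"
    using matrix_compose[OF lin] id by (simp add: o_def matrix_id_mat_1[unfolded id_def])
  ultimately show ?thesis by (metis invertible_left_inverse)
qed

section \<open>Fisher metric and Amari-Chentsov tensors\<close>

context nef_carrier
begin

lemma expect_inner: "\<eta> \<in> N \<Longrightarrow> expect (\<lambda>x. x \<bullet> v) \<eta> = (\<Sum>a\<in>UNIV. v $ a * expect (\<lambda>x. x $ a) \<eta>)"
  by (simp add: inner_vec_def mult.commute[of _ "v $ _"])

lemma hessian_log_partition:
  "\<eta> \<in> N \<Longrightarrow> hessian (log_partition \<mu>) \<eta> = (\<chi> i j. central2 i j \<eta>)"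
  unfolding hessian_def by (simp only: cumulant2)

text \<open>Bilinearity of the covariance; with \<open>v = w\<close> the right-hand side is a
  variance.\<close>

lemma quadratic_form_central2:
  assumes "\<eta> \<in> N"
  shows "(\<Sum>a\<in>UNIV. \<Sum>b\<in>UNIV. v $ a * w $ b * central2 a b \<eta>)
    = expect (\<lambda>x. (\<Sum>a\<in>UNIV. v $ a * (x $ a - expect (\<lambda>y. y $ a) \<eta>))
        * (\<Sum>b\<in>UNIV. w $ b * (x $ b - expect (\<lambda>y. y $ b) \<eta>))) \<eta>"
proof -
  have "(\<Sum>a\<in>UNIV. v $ a * (x $ a - expect (\<lambda>y. y $ a) \<eta>))
        * (\<Sum>b\<in>UNIV. w $ b * (x $ b - expect (\<lambda>y. y $ b) \<eta>))
    = (\<Sum>a\<in>UNIV. \<Sum>b\<in>UNIV. (v $ a * w $ b) *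
        ((x $ a - expect (\<lambda>y. y $ a) \<eta>) * (x $ b - expect (\<lambda>y. y $ b) \<eta>)))" for x
    by (simp add: sum_product mult_ac)
  then show ?thesis using assms
    by (simp del: expect_diff expect_cmult
        add: expect_cmult[where f = "\<lambda>x. (x $ _ - _) * (x $ _ - _)"] central2_def)
qed

text \<open>For a kernel vector \<open>v\<close> the variance of \<open>x \<bullet> v\<close> is
  zero, so \<open>x \<bullet> v\<close> is almost everywhere constant. If \<open>v\<close> is
  nonzero, the carrier lies on a hyperplane, against minimality.\<close>

lemma invertible_hessian:
  assumes "\<eta> \<in> N"
  shows "invertible (hessian (log_partition \<mu>) \<eta>)"
proof -
  define H where "H = hessian (log_partition \<mu>) \<eta>"
  have "v = 0" if "H *v v = 0" for v
  proof (rule ccontr)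
    assume "v \<noteq> 0"
    define m where "m = (\<chi> a. expect (\<lambda>x. x $ a) \<eta>)"
    have sm: "subexponential (\<lambda>x. (x - m) \<bullet> v)" by (simp add: inner_diff_left)
    have "0 = v \<bullet> (H *v v)" using that by simp
    also have "\<dots> = (\<Sum>a\<in>UNIV. \<Sum>b\<in>UNIV. v $ a * v $ b * central2 a b \<eta>)"
      using assms by (simp add: H_def hessian_log_partition inner_vec_def matrix_vector_mult_def
          sum_distrib_left mult_ac)
    also have "\<dots> = expect (\<lambda>x. ((x - m) \<bullet> v) * ((x - m) \<bullet> v)) \<eta>"
      using assms by (simp only: quadratic_form_central2) (simp add: m_def inner_vec_def mult.commute)
    finally have "laplace (\<lambda>x. ((x - m) \<bullet> v) * ((x - m) \<bullet> v)) \<eta> = 0"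
      using assms laplace_pos[OF assms] by (simp add: expect_eq)
    moreover have "integrable \<mu> (\<lambda>x. ((x - m) \<bullet> v) * ((x - m) \<bullet> v) * exp (x \<bullet> \<eta>))"
      using assms sm by (intro integrable_subexponential) auto
    ultimately have "AE x in \<mu>. ((x - m) \<bullet> v) * ((x - m) \<bullet> v) * exp (x \<bullet> \<eta>) = 0"
      unfolding laplace_def by (subst (asm) integral_nonneg_eq_0_iff_AE) auto
    then have "AE x in \<mu>. x \<in> {x. v \<bullet> x = v \<bullet> m}"
      by eventually_elim (simp add: inner_diff_left inner_commute[of v])
    moreover have "affine {x. v \<bullet> x = v \<bullet> m}" by (rule affine_hyperplane)
    moreover have "m + v \<notin> {x. v \<bullet> x = v \<bullet> m}" using \<open>v \<noteq> 0\<close> by (simp add: inner_add_right)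
    ultimately show False using minimal unfolding minimal_carrier_def by blast
  qed
  then show ?thesis
    unfolding H_def[symmetric] invertible_left_inverse matrix_left_invertible_ker by blast
qed

text \<open>The log density is \<open>x \<bullet> \<phi> t - log_partition \<mu> (\<phi> t)\<close>,
  and the gradient of the log-partition function is the mean.\<close>

lemma partial_deriv_log_density:
  assumes "\<phi> differentiable at \<theta>" "\<phi> \<theta> \<in> N"
  shows "partial_deriv i (\<lambda>t. ln (nef_density \<mu> \<phi> x t)) \<theta>
    = (\<Sum>a\<in>UNIV. partial_deriv i \<phi> \<theta> $ a * (x $ a - expect (\<lambda>y. y $ a) (\<phi> \<theta>)))"
proof -
  obtain D where D: "(\<phi> has_derivative D) (at \<theta>)"
    using assms(1) unfolding differentiable_def by blast
  have "((\<lambda>t. x \<bullet> \<phi> t - log_partition \<mu> (\<phi> t)) has_derivative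
      (\<lambda>h. x \<bullet> D h - expect (\<lambda>y. y \<bullet> D h) (\<phi> \<theta>))) (at \<theta>)"
    by (intro has_derivative_diff has_derivative_inner_right D
        has_derivative_compose[OF D has_derivative_log_partition[OF assms(2)]])
  then have "partial_deriv i (\<lambda>t. ln (nef_density \<mu> \<phi> x t)) \<theta>
      = x \<bullet> D (axis i 1) - expect (\<lambda>y. y \<bullet> D (axis i 1)) (\<phi> \<theta>)"
    unfolding nef_density_def ln_exp by (rule partial_deriv_eq)
  then show ?thesis
    using assms(2) by (simp add: expect_inner partial_deriv_eq[OF D])
      (simp add: inner_vec_def sum_subtractf[symmetric] algebra_simps)
qed

text \<open>Differentiating the score gives two terms. The one with second derivatives of \<phi>
  multiplies centred coordinates and has expectation zero; the other contains the derivative of the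
  mean, which is the covariance.\<close>

lemma fisher_metric_eq:
  assumes "open S" "\<theta> \<in> S" "smooth_on S \<phi>" "\<And>t. t \<in> S \<Longrightarrow> \<phi> t \<in> N"
  shows "fisher_metric \<mu> (nef_density \<mu> \<phi>) \<theta> $ i $ j
    = (\<Sum>a\<in>UNIV. \<Sum>b\<in>UNIV. partial_deriv i \<phi> \<theta> $ a * partial_deriv j \<phi> \<theta> $ b * central2 a b (\<phi> \<theta>))"
proof -
  define J where "J = partial_deriv j \<phi>"
  define m where "m a = expect (\<lambda>y. y $ a)" for a :: 'd
  have diff: "\<phi> differentiable at t" if "t \<in> S" for t
    using assms(3) that unfolding smooth_on_def by (auto dest: spec[of _ "[]"])
  have "J differentiable at \<theta>"
    using assms(2,3) unfolding smooth_on_def J_def by (auto dest: spec[of _ "[j]"])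
  then obtain D DJ where D: "(\<phi> has_derivative D) (at \<theta>)" and DJ: "(J has_derivative DJ) (at \<theta>)"
    using diff[OF assms(2)] unfolding differentiable_def by blast
  have N: "\<phi> \<theta> \<in> N" using assms by simp
  define Dm where "Dm a h = expect (\<lambda>x. x $ a * (x \<bullet> h)) (\<phi> \<theta>) - m a (\<phi> \<theta>) * expect (\<lambda>x. x \<bullet> h) (\<phi> \<theta>)" for a h
  have m: "((\<lambda>t. m a (\<phi> t)) has_derivative (\<lambda>h. Dm a (D h))) (at \<theta>)" for a
    using has_derivative_compose[OF D has_derivative_mean[OF N]] by (simp add: m_def Dm_def)
  have J: "((\<lambda>t. J t $ a) has_derivative (\<lambda>h. DJ h $ a)) (at \<theta>)" for a
    using has_derivative_compose[OF DJ bounded_linear_imp_has_derivative[OF bounded_linear_vec_nth]] .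
  have Dm: "Dm a h = (\<Sum>b\<in>UNIV. h $ b * central2 a b (\<phi> \<theta>))" for a h
  proof -
    have "x $ a * (x \<bullet> h) = (\<Sum>b\<in>UNIV. h $ b * (x $ a * x $ b))" for x :: "real ^ 'd"
      by (simp add: inner_vec_def sum_distrib_left mult_ac)
    then have "expect (\<lambda>x. x $ a * (x \<bullet> h)) (\<phi> \<theta>)
        = (\<Sum>b\<in>UNIV. h $ b * expect (\<lambda>x. x $ a * x $ b) (\<phi> \<theta>))"
      using N by simp
    then show ?thesis
      using N by (simp add: Dm_def expect_inner m_def central2_raw sum_distrib_left
          sum_subtractf[symmetric] right_diff_distrib mult_ac)
  qed
  have "partial_derivs [i, j] (\<lambda>t. ln (nef_density \<mu> \<phi> x t)) \<theta>
    = (\<Sum>a\<in>UNIV. DJ (axis i 1) $ a * (x $ a - m a (\<phi> \<theta>)) - J \<theta> $ a * Dm a (D (axis i 1)))" for x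
  proof -
    have "partial_derivs [i, j] (\<lambda>t. ln (nef_density \<mu> \<phi> x t)) \<theta>
      = partial_deriv i (\<lambda>t. \<Sum>a\<in>UNIV. J t $ a * (x $ a - m a (\<phi> t))) \<theta>"
      by (simp, rule partial_deriv_cong_open[OF assms(1,2)])
         (simp add: partial_deriv_log_density diff assms(4) J_def m_def)
    also have "\<dots> = (\<Sum>a\<in>UNIV. J \<theta> $ a * (0 - Dm a (D (axis i 1))) + DJ (axis i 1) $ a * (x $ a - m a (\<phi> \<theta>)))"
      by (rule partial_deriv_eq) (intro has_derivative_sum has_derivative_mult has_derivative_diff
          has_derivative_const J m)
    finally show ?thesis by (simp add: algebra_simps)
  qed
  then have "fisher_metric \<mu> (nef_density \<mu> \<phi>) \<theta> $ i $ j = - expect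
      (\<lambda>x. \<Sum>a\<in>UNIV. DJ (axis i 1) $ a * (x $ a - m a (\<phi> \<theta>)) - J \<theta> $ a * Dm a (D (axis i 1))) (\<phi> \<theta>)"
    unfolding fisher_metric_def expect_def by (simp add: nef_density_def)
  \<comment> \<open>The terms in \<open>DJ\<close> vanish here, since the expectation of
    \<open>x $ a\<close> is \<open>m a (\<phi> \<theta>)\<close>.\<close>
  also have "\<dots> = (\<Sum>a\<in>UNIV. J \<theta> $ a * Dm a (D (axis i 1)))"
    using N by (simp add: m_def sum_negf)
  also have "\<dots> = (\<Sum>a\<in>UNIV. \<Sum>b\<in>UNIV. J \<theta> $ a * D (axis i 1) $ b * central2 b a (\<phi> \<theta>))"
    by (simp add: Dm sum_distrib_left mult_ac central2_commute)
  finally show ?thesis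
    by (subst sum.swap) (simp add: J_def partial_deriv_eq[OF D] mult_ac)
qed

text \<open>Third cumulants are third central moments, so the cubic contractions carry over
  unchanged. Only the quartic one is corrected by the pairings, and its factor 1/8 accounts for the
  last term.\<close>

lemma F1_invariant:
  fixes \<phi> :: "real ^ 'd \<Rightarrow> real ^ 'd"
  assumes diffeo: "diffeomorphism_between S N \<phi>" and \<theta>: "\<theta> \<in> S"
  defines "AC is \<equiv> amari_chentsov \<mu> (nef_density \<mu> \<phi>) is \<theta>"
    and "g i j \<equiv> matrix_inv (fisher_metric \<mu> (nef_density \<mu> \<phi>) \<theta>) $ i $ j"
    and "d \<equiv> real CARD('d)"
  shows "F1 \<mu> \<phi> \<theta> =
        1 / 8 * (\<Sum>i1\<in>UNIV. \<Sum>i2\<in>UNIV. \<Sum>i3\<in>UNIV. \<Sum>i4\<in>UNIV.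
                   AC [i1, i2, i3, i4] * g i1 i2 * g i3 i4)
      - 1 / 8 * (\<Sum>i1\<in>UNIV. \<Sum>i2\<in>UNIV. \<Sum>i3\<in>UNIV. \<Sum>i4\<in>UNIV. \<Sum>i5\<in>UNIV. \<Sum>i6\<in>UNIV.
                   AC [i1, i2, i3] * AC [i4, i5, i6] * g i1 i2 * g i3 i4 * g i5 i6)
      - 1 / 12 * (\<Sum>i1\<in>UNIV. \<Sum>i2\<in>UNIV. \<Sum>i3\<in>UNIV. \<Sum>i4\<in>UNIV. \<Sum>i5\<in>UNIV. \<Sum>i6\<in>UNIV.
                   AC [i1, i2, i3] * AC [i4, i5, i6] * g i1 i4 * g i2 i5 * g i3 i6)
      - (d\<^sup>2 + 2 * d) / 8"
proof -
  define \<eta> where "\<eta> = \<phi> \<theta>"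
  define J where "J = (\<chi> a i. partial_deriv i \<phi> \<theta> $ a)"
  define H where "H = hessian (log_partition \<mu>) \<eta>"
  define \<gamma> where "\<gamma> = matrix_inv H"
  define G where "G = matrix_inv (fisher_metric \<mu> (nef_density \<mu> \<phi>) \<theta>)"
  \<comment> \<open>\<open>s\<close> is the centred coordinate and \<open>y\<close> the score, that
    is, the transposed Jacobian applied to \<open>s\<close>.\<close>
  define s where "s a x = x $ a - expect (\<lambda>y. y $ a) \<eta>" for a and x :: "real ^ 'd"
  define y where "y i x = (\<Sum>a\<in>UNIV. J $ a $ i * s a x)" for i and x :: "real ^ 'd"
  have S: "open S" "smooth_on S \<phi>" and mem: "\<And>t. t \<in> S \<Longrightarrow> \<phi> t \<in> N"
    using diffeo unfolding diffeomorphism_between_def by (auto dest: bij_betw_apply)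
  have \<eta>: "\<eta> \<in> N" using mem \<theta> by (simp add: \<eta>_def)
  have diff: "\<phi> differentiable at \<theta>"
    using S(2) \<theta> unfolding smooth_on_def by (auto dest: spec[of _ "[]"])
  have H_nth: "H $ a $ b = central2 a b \<eta>" for a b
    by (simp add: H_def hessian_log_partition \<eta>)
  have invH: "invertible H" unfolding H_def by (rule invertible_hessian[OF \<eta>])
  have invJ: "invertible J" unfolding J_def using diffeo \<theta> by (rule jacobian_invertible)
  have "fisher_metric \<mu> (nef_density \<mu> \<phi>) \<theta> = transpose J ** H ** J"
  proof -
    have "fisher_metric \<mu> (nef_density \<mu> \<phi>) \<theta> $ i $ j = (transpose J ** H ** J) $ i $ j" for i j
      by (subst fisher_metric_eq[OF S(1) \<theta> S(2)], erule mem, subst sum.swap) (simp add: matrix_matrix_mult_def transpose_def sum_distrib_left sum_distrib_right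
          H_nth J_def \<eta>_def mult_ac)
    then show ?thesis by (simp add: vec_eq_iff)
  qed
  then have \<gamma>_eq: "\<gamma> = J ** G ** transpose J"
    unfolding \<gamma>_def G_def by (simp add: congruence_matrix_inv[OF invH invJ])
  \<comment> \<open>The pointwise invariance: moving \<open>transpose J\<close> across the inner
    product turns \<open>G\<close> into \<open>J ** G ** transpose J\<close>, which is
    \<gamma>.\<close>
  have q_eq: "(\<Sum>i\<in>UNIV. \<Sum>j\<in>UNIV. y i x * y j z * G $ i $ j)
      = (\<Sum>a\<in>UNIV. \<Sum>b\<in>UNIV. s a x * s b z * \<gamma> $ a $ b)" for x z
  proof -
    define u v where "u = (\<chi> a. s a x)" and "v = (\<chi> a. s a z)"
    have "(\<Sum>i\<in>UNIV. \<Sum>j\<in>UNIV. y i x * y j z * G $ i $ j) = (transpose J *v u) \<bullet> (G *v (transpose J *v v))"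
      by (simp add: y_def u_def v_def inner_vec_def matrix_vector_mult_def transpose_def
          sum_distrib_left mult_ac)
    also have "\<dots> = u \<bullet> (\<gamma> *v v)"
      by (simp only: \<gamma>_eq transpose_matrix_vector[of J u] dot_lmul_matrix
          matrix_vector_mul_assoc matrix_mul_assoc)
    also have "\<dots> = (\<Sum>a\<in>UNIV. \<Sum>b\<in>UNIV. s a x * s b z * \<gamma> $ a $ b)"
      by (simp add: u_def v_def inner_vec_def matrix_vector_mult_def sum_distrib_left mult_ac)
    finally show ?thesis .
  qed
  have sub: "subexponential (s a)" "subexponential (y i)" for a i
    by (auto simp: s_def[abs_def] y_def[abs_def])
  have AC: "AC is = expect (\<lambda>x. \<Prod>j<length is. y (is ! j) x) \<eta>" for "is"
    unfolding AC_def amari_chentsov_def expect_def partial_deriv_log_density[OF diff mem[OF \<theta>]]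
    by (simp add: y_def s_def J_def \<eta>_def nef_density_def expect_def)
  have AC3: "AC [i, j, k] = expect (\<lambda>x. y i x * y j x * y k x) \<eta>" for i j k
    by (simp add: AC lessThan_Suc mult_ac)
  have AC4: "AC [i, j, k, l] = expect (\<lambda>x. y i x * y j x * y k x * y l x) \<eta>" for i j k l
    by (simp add: AC lessThan_Suc mult_ac)
  have c3: "central3 i j k \<eta> = expect (\<lambda>x. s i x * s j x * s k x) \<eta>" for i j k
    by (simp add: central3_def s_def)
  have c4: "central4 i j k l \<eta> = expect (\<lambda>x. s i x * s j x * s k x * s l x) \<eta>" for i j k l
    by (simp add: central4_def s_def)
  \<comment> \<open>Both sides are expectations of the same function by \<open>q_eq\<close>; the two
    cubic identities below rest on the same fact.\<close>
  have sum4: "(\<Sum>i1\<in>UNIV. \<Sum>i2\<in>UNIV. \<Sum>i3\<in>UNIV. \<Sum>i4\<in>UNIV.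
      central4 i1 i2 i3 i4 \<eta> * \<gamma> $ i1 $ i2 * \<gamma> $ i3 $ i4)
    = (\<Sum>i1\<in>UNIV. \<Sum>i2\<in>UNIV. \<Sum>i3\<in>UNIV. \<Sum>i4\<in>UNIV. AC [i1, i2, i3, i4] * g i1 i2 * g i3 i4)"
    unfolding c4 AC4 g_def G_def[symmetric]
    by (simp only: expect_contract4[where G = "\<lambda>i j. \<gamma> $ i $ j" and y = s, OF sub(1) \<eta>]
        expect_contract4[where G = "\<lambda>i j. G $ i $ j" and y = y, OF sub(2) \<eta>] q_eq)
  note contract33_s = expect_contract33[where G = "\<lambda>i j. \<gamma> $ i $ j" and y = s, OF sub(1) \<eta>]
  note contract33_y = expect_contract33[where G = "\<lambda>i j. G $ i $ j" and y = y, OF sub(2) \<eta>]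
  have sum33: "(\<Sum>i1\<in>UNIV. \<Sum>i2\<in>UNIV. \<Sum>i3\<in>UNIV. \<Sum>i4\<in>UNIV. \<Sum>i5\<in>UNIV. \<Sum>i6\<in>UNIV.
      central3 i1 i2 i3 \<eta> * central3 i4 i5 i6 \<eta> * \<gamma> $ i1 $ i2 * \<gamma> $ i3 $ i4 * \<gamma> $ i5 $ i6)
    = (\<Sum>i1\<in>UNIV. \<Sum>i2\<in>UNIV. \<Sum>i3\<in>UNIV. \<Sum>i4\<in>UNIV. \<Sum>i5\<in>UNIV. \<Sum>i6\<in>UNIV.
        AC [i1, i2, i3] * AC [i4, i5, i6] * g i1 i2 * g i3 i4 * g i5 i6)"
    unfolding c3 AC3 g_def G_def[symmetric] by (simp only: contract33_s(1) contract33_y(1) q_eq)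
  have sum33': "(\<Sum>i1\<in>UNIV. \<Sum>i2\<in>UNIV. \<Sum>i3\<in>UNIV. \<Sum>i4\<in>UNIV. \<Sum>i5\<in>UNIV. \<Sum>i6\<in>UNIV.
      central3 i1 i2 i3 \<eta> * central3 i4 i5 i6 \<eta> * \<gamma> $ i1 $ i4 * \<gamma> $ i2 $ i5 * \<gamma> $ i3 $ i6)
    = (\<Sum>i1\<in>UNIV. \<Sum>i2\<in>UNIV. \<Sum>i3\<in>UNIV. \<Sum>i4\<in>UNIV. \<Sum>i5\<in>UNIV. \<Sum>i6\<in>UNIV.
        AC [i1, i2, i3] * AC [i4, i5, i6] * g i1 i4 * g i2 i5 * g i3 i6)"
    unfolding c3 AC3 g_def G_def[symmetric] by (simp only: contract33_s(2) contract33_y(2) q_eq)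
  have "transpose H = H"
    by (simp add: vec_eq_iff transpose_def H_nth central2_commute)
  moreover have "\<gamma> ** H = mat 1" unfolding \<gamma>_def using invH by (rule matrix_inv_left)
  ultimately have pairings: "(\<Sum>i1\<in>UNIV. \<Sum>i2\<in>UNIV. \<Sum>i3\<in>UNIV. \<Sum>i4\<in>UNIV.
     (H $ i1 $ i2 * H $ i3 $ i4 + H $ i1 $ i3 * H $ i2 $ i4 + H $ i1 $ i4 * H $ i2 $ i3)
       * \<gamma> $ i1 $ i2 * \<gamma> $ i3 $ i4) = d\<^sup>2 + 2 * d"
    unfolding d_def by (intro sum_metric_pairings)
  \<comment> \<open>The quartic cumulants are split by \<open>cumulant4\<close> into central
    moments, handled by \<open>sum4\<close>, and covariance pairings, handled by
    \<open>pairings\<close>.\<close>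
  have "(\<Sum>i1\<in>UNIV. \<Sum>i2\<in>UNIV. \<Sum>i3\<in>UNIV. \<Sum>i4\<in>UNIV.
      partial_derivs [i1, i2, i3, i4] (log_partition \<mu>) \<eta> * \<gamma> $ i1 $ i2 * \<gamma> $ i3 $ i4)
    = (\<Sum>i1\<in>UNIV. \<Sum>i2\<in>UNIV. \<Sum>i3\<in>UNIV. \<Sum>i4\<in>UNIV.
        AC [i1, i2, i3, i4] * g i1 i2 * g i3 i4) - (d\<^sup>2 + 2 * d)"
    unfolding sum4[symmetric] pairings[symmetric] sum_subtractf[symmetric] cumulant4[OF \<eta>] H_nth
    by (intro sum.cong refl) (simp add: algebra_simps)
  then show ?thesis
    unfolding F1_def F1_nat_def Let_def \<eta>_def[symmetric] H_def[symmetric] \<gamma>_def[symmetric]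
    by (simp only: cumulant3[OF \<eta>] sum33 sum33') (simp add: field_simps)
qed

end

theorem mainTheorem4:
  fixes M :: "(real ^ 'd) measure set"
    and \<mu>1 :: "(real ^ 'd) measure"
    and \<Theta> :: "(real ^ 'd) set"
    and \<eta> :: "real ^ 'd \<Rightarrow> real ^ 'd"
  assumes family: "natural_exponential_family M \<mu>1 \<Theta> \<eta>"
    and order_d: "minimal_carrier \<mu>1"
  shows "\<forall>\<theta>\<in>\<Theta>.
    (let AC = (\<lambda>is. amari_chentsov \<mu>1 (nef_density \<mu>1 \<eta>) is \<theta>);
         g = (\<lambda>i j. matrix_inv (fisher_metric \<mu>1 (nef_density \<mu>1 \<eta>) \<theta>) $ i $ j);
         d = real CARD('d)
     in F1 \<mu>1 \<eta> \<theta> =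
        1 / 8 * (\<Sum>i1\<in>UNIV. \<Sum>i2\<in>UNIV. \<Sum>i3\<in>UNIV. \<Sum>i4\<in>UNIV.
                   AC [i1, i2, i3, i4] * g i1 i2 * g i3 i4)
      - 1 / 8 * (\<Sum>i1\<in>UNIV. \<Sum>i2\<in>UNIV. \<Sum>i3\<in>UNIV. \<Sum>i4\<in>UNIV. \<Sum>i5\<in>UNIV. \<Sum>i6\<in>UNIV.
                   AC [i1, i2, i3] * AC [i4, i5, i6] * g i1 i2 * g i3 i4 * g i5 i6)
      - 1 / 12 * (\<Sum>i1\<in>UNIV. \<Sum>i2\<in>UNIV. \<Sum>i3\<in>UNIV. \<Sum>i4\<in>UNIV. \<Sum>i5\<in>UNIV. \<Sum>i6\<in>UNIV.
                   AC [i1, i2, i3] * AC [i4, i5, i6] * g i1 i4 * g i2 i5 * g i3 i6)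
      - (d\<^sup>2 + 2 * d) / 8)"
proof
  fix \<theta> assume \<theta>: "\<theta> \<in> \<Theta>"
  have carrier: "sets \<mu>1 = sets borel"
    and diffeo: "diffeomorphism_between \<Theta> (natural_parameter_space \<mu>1) \<eta>"
    using family unfolding natural_exponential_family_def by auto
  \<comment> \<open>Openness of the natural parameter space is part of the diffeomorphism
    hypothesis.\<close>
  interpret nef_carrier \<mu>1
    using carrier diffeo order_d by unfold_locales (auto simp: diffeomorphism_between_def)
  show "(let AC = (\<lambda>is. amari_chentsov \<mu>1 (nef_density \<mu>1 \<eta>) is \<theta>);
         g = (\<lambda>i j. matrix_inv (fisher_metric \<mu>1 (nef_density \<mu>1 \<eta>) \<theta>) $ i $ j);
         d = real CARD('d)
     in F1 \<mu>1 \<eta> \<theta> =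
        1 / 8 * (\<Sum>i1\<in>UNIV. \<Sum>i2\<in>UNIV. \<Sum>i3\<in>UNIV. \<Sum>i4\<in>UNIV.
                   AC [i1, i2, i3, i4] * g i1 i2 * g i3 i4)
      - 1 / 8 * (\<Sum>i1\<in>UNIV. \<Sum>i2\<in>UNIV. \<Sum>i3\<in>UNIV. \<Sum>i4\<in>UNIV. \<Sum>i5\<in>UNIV. \<Sum>i6\<in>UNIV.
                   AC [i1, i2, i3] * AC [i4, i5, i6] * g i1 i2 * g i3 i4 * g i5 i6)
      - 1 / 12 * (\<Sum>i1\<in>UNIV. \<Sum>i2\<in>UNIV. \<Sum>i3\<in>UNIV. \<Sum>i4\<in>UNIV. \<Sum>i5\<in>UNIV. \<Sum>i6\<in>UNIV.
                   AC [i1, i2, i3] * AC [i4, i5, i6] * g i1 i4 * g i2 i5 * g i3 i6)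
      - (d\<^sup>2 + 2 * d) / 8)"
    unfolding Let_def by (rule F1_invariant[OF diffeo \<theta>])
qed

end
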